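(* Let $\xi(t)$, $t\in\mathbb{Z}$, be a real-valued stationary random process with $\langle \xi(t)\rangle=0$ and $\langle \xi^2(t)\rangle=1$, with correlation function $b(t)=\langle \xi(t+t')\xi(t')\rangle$, let $Q_N=(b(j-k))_{j,k=0}^{N-1}$, $N=1,2,\dots$, and let $\lambda_m(N)=\|Q_N\|$ be the maximal eigenvalue (equivalently, the Hilbert operator norm) of $Q_N$. Then the process $\xi(t)$ is stable if and only if $$\lim_{N\to\infty}\frac{\lambda_m(N)}{N}\ \left(=\lim_{N\to\infty}\frac{1}{N}\|Q_N\|\right)=0.$$
   Context: $\langle\cdot\rangle$ denotes the mean (expectation); by stationarity $b(t)=\langle\xi(t+t')\xi(t')\rangle$ does not depend on $t'\in\mathbb{Z}$. The correlation function $b$ is a real-valued sequence admitting the representation $$b(t)=\int_{-\pi}^{\pi}e^{it\theta}\,d\sigma(\theta),\quad t\in\mathbb{Z},$$ where the spectral distribution function $\sigma$ is a non-decreasing bounded function on $[-\pi,\pi]$, with $b(0)=\sigma(\pi)-\sigma(-\pi)=1$ and $\sigma(\theta_2)-\sigma(\theta_1)=\sigma(-\theta_1)-\sigma(-\theta_2)$ for all $0\le\theta_1\le\theta_2\le\pi$. The process $\xi(t)$ is called stable if $\sigma$ is continuous on $[-\pi,\pi]$, and unstable otherwise. The Hilbert norm $\|\cdot\|$ of an $N\times N$ matrix is its operator norm on $\mathbb{C}^N$ with the standard scalar product. *)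

theory Defs
  imports "HOL-Probability.Probability" "Jordan_Normal_Form.Char_Poly"
begin

text \<open>
  Stationarity is understood in the wide sense (second-order stationarity); strictly stationary
  processes with finite second moments are a special case.
\<close>

definition stationary_process :: "'a measure \<Rightarrow> (int \<Rightarrow> 'a \<Rightarrow> real) \<Rightarrow> bool" where
  "stationary_process M \<xi> \<longleftrightarrow>
     (\<forall>t. \<xi> t \<in> borel_measurable M \<and> integrable M (\<lambda>\<omega>. (\<xi> t \<omega>)\<^sup>2)) \<and>
     (\<forall>t t'. (\<integral>\<omega>. \<xi> t \<omega> \<partial>M) = (\<integral>\<omega>. \<xi> t' \<omega> \<partial>M)) \<and>
     (\<forall>t t' t''. (\<integral>\<omega>. \<xi> (t + t') \<omega> * \<xi> t' \<omega> \<partial>M) = (\<integral>\<omega>. \<xi> (t + t'') \<omega> * \<xi> t'' \<omega> \<partial>M))"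

text \<open>For a stationary process the base point \<open>t'\<close> is immaterial, so \<open>t' = 0\<close> is used.\<close>

definition correlation_function :: "'a measure \<Rightarrow> (int \<Rightarrow> 'a \<Rightarrow> real) \<Rightarrow> int \<Rightarrow> real" where
  "correlation_function M \<xi> t = (\<integral>\<omega>. \<xi> t \<omega> * \<xi> 0 \<omega> \<partial>M)"

text \<open>
  Riemann--Stieltjes integral of \<open>f\<close> with respect to \<open>\<sigma>\<close> over \<open>[a, b]\<close>, as the limit of
  Riemann--Stieltjes sums when the mesh tends to zero. The Lebesgue--Stieltjes measure
  \<^const>\<open>interval_measure\<close> cannot be used directly: it requires right-continuity, which is
  incompatible with the symmetry condition on spectral distribution functions below as soon
  as there are jumps in the interior of the interval.
\<close>

definition has_stieltjes_integral ::
    "(real \<Rightarrow> complex) \<Rightarrow> (real \<Rightarrow> real) \<Rightarrow> real \<Rightarrow> real \<Rightarrow> complex \<Rightarrow> bool" where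
  "has_stieltjes_integral f \<sigma> a b I \<longleftrightarrow>
     (\<forall>\<epsilon>>0. \<exists>\<delta>>0. \<forall>p. p tagged_division_of {a..b} \<and> (\<lambda>x. ball x \<delta>) fine p \<longrightarrow>
        norm ((\<Sum>(x, K)\<in>p. (\<sigma> (Sup K) - \<sigma> (Inf K)) *\<^sub>R f x) - I) < \<epsilon>)"

definition spectral_distribution_function :: "(int \<Rightarrow> real) \<Rightarrow> (real \<Rightarrow> real) \<Rightarrow> bool" where
  "spectral_distribution_function b \<sigma> \<longleftrightarrow>
     mono_on {-pi..pi} \<sigma> \<and>
     bounded (\<sigma> ` {-pi..pi}) \<and>
     b 0 = \<sigma> pi - \<sigma> (-pi) \<and> \<sigma> pi - \<sigma> (-pi) = 1 \<and>
     (\<forall>\<theta>\<^sub>1 \<theta>\<^sub>2. 0 \<le> \<theta>\<^sub>1 \<and> \<theta>\<^sub>1 \<le> \<theta>\<^sub>2 \<and> \<theta>\<^sub>2 \<le> pi \<longrightarrow>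
        \<sigma> \<theta>\<^sub>2 - \<sigma> \<theta>\<^sub>1 = \<sigma> (-\<theta>\<^sub>1) - \<sigma> (-\<theta>\<^sub>2)) \<and>
     (\<forall>t. has_stieltjes_integral (\<lambda>\<theta>. exp (\<i> * of_int t * of_real \<theta>)) \<sigma> (-pi) pi
        (of_real (b t)))"

text \<open>
  A spectral distribution function of \<open>b\<close> is determined only up to an additive constant and its
  values at interior jumps, while the positions and sizes of the jumps are determined by \<open>b\<close>.
  So either all spectral distribution functions of the process are continuous or none is.
\<close>

definition stable_process :: "'a measure \<Rightarrow> (int \<Rightarrow> 'a \<Rightarrow> real) \<Rightarrow> bool" where
  "stable_process M \<xi> \<longleftrightarrow>
     (\<exists>\<sigma>. spectral_distribution_function (correlation_function M \<xi>) \<sigma> \<and>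
          continuous_on {-pi..pi} \<sigma>)"

definition correlation_matrix :: "(int \<Rightarrow> real) \<Rightarrow> nat \<Rightarrow> complex mat" where
  "correlation_matrix b N = mat N N (\<lambda>(j, k). of_real (b (int j - int k)))"

definition hilbert_norm_vec :: "complex vec \<Rightarrow> real" where
  "hilbert_norm_vec v = sqrt (Re (v \<bullet>c v))"

definition hilbert_norm_mat :: "complex mat \<Rightarrow> real" where
  "hilbert_norm_mat A =
     Sup {hilbert_norm_vec (A *\<^sub>v v) |v. v \<in> carrier_vec (dim_col A) \<and> hilbert_norm_vec v \<le> 1}"

text \<open>
  Intended for Hermitian matrices of positive size, all of whose eigenvalues are real and for
  which the set below is finite and nonempty.
\<close>

definition max_eigenvalue :: "complex mat \<Rightarrow> real" where
  "max_eigenvalue A = Max {r. eigenvalue A (of_real r)}"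

end

theory Submission
  imports Defs
begin

text \<open>
  Being a correlation function, \<open>b\<close> is positive definite, so \<open>Q N\<close> is Hermitian and positive
  semidefinite, and for such a matrix the operator norm is the largest eigenvalue
  (\<open>max_eigenvalue_eq_hilbert_norm_mat\<close>). It remains to see that \<open>\<parallel>Q N\<parallel> / N\<close> tends to 0 exactly if the
  spectral measure has no atoms, continuity of a distribution function being the absence of atoms.

  If the process is stable, its continuous spectral distribution function defines a measure \<open>\<mu>\<close> without
  atoms and with Fourier coefficients \<open>b\<close>
  (\<open>spectral_measure_of_continuous_distribution_function\<close>). Estimating the operator norm by the
  Hilbert--Schmidt norm bounds \<open>(\<parallel>Q N\<parallel> / N)\<^sup>2\<close> by twice the mean of \<open>b\<^sup>2\<close> over \<open>{0..<N}\<close>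
  (\<open>correlation_matrix_norm_le\<close>), and this mean tends to 0 by Wiener's lemma (\<open>wiener_atomless\<close>).

  If conversely \<open>\<parallel>Q N\<parallel> / N\<close> tends to 0, a spectral measure \<open>\<mu>\<close> has to be constructed first. This is
  Herglotz's theorem (\<open>herglotz\<close>), obtained from Fejer means and Helly's selection theorem. Testing \<open>Q N\<close>
  on the vector \<open>(iexp (k * x))\<close> shows that the mass of \<open>\<mu>\<close> at \<open>x\<close> is at most \<open>\<parallel>Q N\<parallel> / N\<close> for every \<open>N\<close>
  (\<open>atom_le_correlation_matrix_norm\<close>). Hence \<open>\<mu>\<close> has no atoms, and its symmetrised distribution function
  is a continuous spectral distribution function
  (\<open>continuous_distribution_function_of_spectral_measure\<close>).
\<close>

section \<open>Stieltjes integrals and measures\<close>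

lemma has_stieltjes_integral_unique:
  assumes "a \<le> b" "has_stieltjes_integral f \<sigma> a b I" "has_stieltjes_integral f \<sigma> a b J"
  shows "I = J"
proof (rule ccontr)
  assume "I \<noteq> J"
  define e where "e = norm (I - J) / 2"
  have e: "e > 0" using \<open>I \<noteq> J\<close> by (simp add: e_def)
  define S where "S p = (\<Sum>(x, K)\<in>p. (\<sigma> (Sup K) - \<sigma> (Inf K)) *\<^sub>R f x)" for p
  obtain d1 where d1: "d1 > 0"
    "\<And>p. p tagged_division_of {a..b} \<Longrightarrow> (\<lambda>x. ball x d1) fine p \<Longrightarrow> norm (S p - I) < e"
    using assms(2)[unfolded has_stieltjes_integral_def, rule_format, OF e] unfolding S_def by auto
  obtain d2 where d2: "d2 > 0"
    "\<And>p. p tagged_division_of {a..b} \<Longrightarrow> (\<lambda>x. ball x d2) fine p \<Longrightarrow> norm (S p - J) < e"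
    using assms(3)[unfolded has_stieltjes_integral_def, rule_format, OF e] unfolding S_def by auto
  have "gauge (\<lambda>x::real. ball x (min d1 d2))"
    using d1 d2 by (intro gauge_ball) auto
  then obtain p where p: "p tagged_division_of {a..b}" "(\<lambda>x. ball x (min d1 d2)) fine p"
    using fine_division_exists_real by blast
  have "(\<lambda>x. ball x d1) fine p" "(\<lambda>x. ball x d2) fine p"
    using p(2) by (auto simp: fine_def subset_iff)
  then have "norm (S p - I) < e" "norm (S p - J) < e"
    using d1(2)[OF p(1)] d2(2)[OF p(1)] by simp_all
  then have "norm ((S p - J) - (S p - I)) < e + e"
    by (smt (verit) norm_triangle_ineq4)
  then show False by (simp add: e_def)
qed

text \<open>
  A spectral distribution function must be odd up to a constant, which the distribution function
  of a measure need not be. Averaging the latter with its reflection repairs this, and the present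
  rule shows that the averaged function has the averaged integrals.
\<close>

lemma has_stieltjes_integral_average:
  assumes "has_stieltjes_integral f \<sigma> a b I" "has_stieltjes_integral f \<tau> a b J"
  shows "has_stieltjes_integral f (\<lambda>x. (\<sigma> x + \<tau> x) / 2) a b ((I + J) / 2)"
  unfolding has_stieltjes_integral_def
proof (intro allI impI)
  fix e :: real assume e: "e > 0"
  define S where "S \<sigma> p = (\<Sum>(x, K)\<in>p. (\<sigma> (Sup K) - \<sigma> (Inf K)) *\<^sub>R f x)" for \<sigma> :: "real \<Rightarrow> real" and p
  obtain d1 where d1: "d1 > 0"
    "\<And>p. p tagged_division_of {a..b} \<Longrightarrow> (\<lambda>x. ball x d1) fine p \<Longrightarrow> norm (S \<sigma> p - I) < e"
    using assms(1)[unfolded has_stieltjes_integral_def, rule_format, OF e] unfolding S_def by auto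
  obtain d2 where d2: "d2 > 0"
    "\<And>p. p tagged_division_of {a..b} \<Longrightarrow> (\<lambda>x. ball x d2) fine p \<Longrightarrow> norm (S \<tau> p - J) < e"
    using assms(2)[unfolded has_stieltjes_integral_def, rule_format, OF e] unfolding S_def by auto
  have "norm (S (\<lambda>x. (\<sigma> x + \<tau> x) / 2) p - (I + J) / 2) < e"
    if p: "p tagged_division_of {a..b}" "(\<lambda>x. ball x (min d1 d2)) fine p" for p
  proof -
    have "(\<lambda>x. ball x d1) fine p" "(\<lambda>x. ball x d2) fine p"
      using p(2) by (auto simp: fine_def subset_iff)
    then have *: "norm (S \<sigma> p - I) < e" "norm (S \<tau> p - J) < e"
      using d1(2)[OF p(1)] d2(2)[OF p(1)] by simp_all
    have "S (\<lambda>x. (\<sigma> x + \<tau> x) / 2) p = (S \<sigma> p + S \<tau> p) / 2"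
      unfolding S_def sum.distrib[symmetric] sum_divide_distrib
      by (intro sum.cong) (auto simp: scaleR_conv_of_real field_simps)
    then have "S (\<lambda>x. (\<sigma> x + \<tau> x) / 2) p - (I + J) / 2 = ((S \<sigma> p - I) + (S \<tau> p - J)) / 2"
      by (simp add: field_simps)
    also have "norm \<dots> = norm ((S \<sigma> p - I) + (S \<tau> p - J)) / 2"
      by (simp add: norm_divide)
    also have "\<dots> < (e + e) / 2"
      by (intro divide_strict_right_mono norm_triangle_lt add_strict_mono *) auto
    finally show ?thesis by simp
  qed
  then show "\<exists>\<delta>>0. \<forall>p. p tagged_division_of {a..b} \<and> (\<lambda>x. ball x \<delta>) fine p \<longrightarrow>
        norm ((\<Sum>(x, K)\<in>p. ((\<sigma> (Sup K) + \<tau> (Sup K)) / 2 - (\<sigma> (Inf K) + \<tau> (Inf K)) / 2) *\<^sub>R f x) - (I + J) / 2) < e"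
    unfolding S_def using d1(1) d2(1) by (intro exI[of _ "min d1 d2"]) auto
qed

text \<open>
  The indefinite integral \<open>F v\<close> of \<open>f\<close> over \<open>{a<..v}\<close> telescopes along every division of \<open>[a, b]\<close>, so
  a Riemann--Stieltjes sum can be compared with \<open>F b\<close> cell by cell. On one cell the error is at most
  the oscillation of \<open>f\<close> there times the measure of the cell. By uniform continuity a single mesh
  makes all these oscillations small, and the measures of the cells add up to a bounded number.
\<close>

lemma has_stieltjes_integral_measure:
  fixes f :: "real \<Rightarrow> complex" and \<mu> :: "real measure"
  assumes \<mu>: "finite_measure \<mu>" and sets: "sets \<mu> = sets borel" and ab: "a \<le> b"
    and cont: "continuous_on {a..b} f"
    and \<sigma>: "\<And>u v. a \<le> u \<Longrightarrow> u \<le> v \<Longrightarrow> v \<le> b \<Longrightarrow> \<sigma> v - \<sigma> u = measure \<mu> {u<..v}"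
  shows "has_stieltjes_integral f \<sigma> a b (LINT x:{a<..b}|\<mu>. f x)"
  unfolding has_stieltjes_integral_def
proof (intro allI impI)
  interpret finite_measure \<mu> by fact
  note [measurable_cong] = sets
  have int: "set_integrable \<mu> {u<..v} f" if "a \<le> u" "v \<le> b" for u v
  proof -
    have "compact (f ` {a..b})"
      using cont by (intro compact_continuous_image) auto
    then obtain B where B: "B > 0" "\<And>x. x \<in> {a..b} \<Longrightarrow> norm (f x) \<le> B"
      by (auto dest!: compact_imp_bounded simp: bounded_pos)
    have meas: "(\<lambda>x. indicator {a..b} x *\<^sub>R f x) \<in> borel_measurable \<mu>"
      using borel_measurable_continuous_on_indicator[OF _ cont] sets
      by (simp add: measurable_cong_sets[OF sets refl])
    have "set_integrable \<mu> {a..b} f"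
      unfolding set_integrable_def
      using B by (intro integrable_const_bound[of _ B] meas) (auto simp: indicator_def)
    then show ?thesis
      by (rule set_integrable_subset) (use that sets in auto)
  qed
  fix e :: real assume e: "e > 0"
  define e' where "e' = e / (measure \<mu> {a<..b} + 1)"
  have e': "e' > 0" using e by (simp add: e'_def add_nonneg_pos)
  have e'e: "e' * measure \<mu> {a<..b} < e"
  proof -
    have "e' * (measure \<mu> {a<..b} + 1) = e"
      using measure_nonneg[of \<mu> "{a<..b}"] by (simp add: e'_def add_nonneg_eq_0_iff)
    then show ?thesis using e' by (simp add: distrib_left)
  qed
  obtain d where d: "d > 0"
    "\<And>x y. x \<in> {a..b} \<Longrightarrow> y \<in> {a..b} \<Longrightarrow> dist y x < d \<Longrightarrow> dist (f y) (f x) < e'"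
    using compact_uniformly_continuous[OF cont] e' unfolding uniformly_continuous_on_def by fastforce
  define F where "F v = (LINT x:{a<..v}|\<mu>. f x)" for v
  have F_diff: "F v - F u = (LINT x:{u<..v}|\<mu>. f x)" if "a \<le> u" "u \<le> v" "v \<le> b" for u v
  proof -
    have "{a<..v} = {a<..u} \<union> {u<..v}" using that by auto
    then show ?thesis
      unfolding F_def using that by (subst \<open>{a<..v} = _\<close>, subst set_integral_Un) (auto intro!: int)
  qed
  have local_bound: "norm ((\<sigma> v - \<sigma> u) *\<^sub>R f c - (F v - F u)) \<le> e' * (\<sigma> v - \<sigma> u)"
    if uv: "a \<le> u" "u \<le> v" "v \<le> b" and c: "c \<in> {u..v}" "{u..v} \<subseteq> ball c d" for u v c
  proof -
    have int_const: "set_integrable \<mu> {u<..v} (\<lambda>_. f c)"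
      unfolding set_integrable_def using sets
      by (intro integrable_const_bound[of _ "norm (f c)"]) (auto simp: indicator_def)
    have "(\<sigma> v - \<sigma> u) *\<^sub>R f c = (LINT x:{u<..v}|\<mu>. f c)"
      unfolding set_lebesgue_integral_def using uv \<sigma> sets sets_eq_imp_space_eq[OF sets]
      by (subst Bochner_Integration.integral_scaleR_left)
        (auto intro!: integrable_real_indicator simp: less_top[symmetric])
    then have "(\<sigma> v - \<sigma> u) *\<^sub>R f c - (F v - F u) = (LINT x:{u<..v}|\<mu>. f c - f x)"
      using uv int[of u v] int_const by (subst set_integral_diff) (auto simp: F_diff)
    also have "norm \<dots> \<le> (LINT x|\<mu>. indicator {u<..v} x * e')"
      unfolding set_lebesgue_integral_def
    proof (rule order_trans[OF Bochner_Integration.integral_norm_bound integral_mono])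
      show "integrable \<mu> (\<lambda>x. norm (indicator {u<..v} x *\<^sub>R (f c - f x)))"
        using set_integral_diff(1)[OF int_const int[of u v]] uv
        by (intro integrable_norm) (simp add: set_integrable_def)
      fix x
      show "norm (indicator {u<..v} x *\<^sub>R (f c - f x)) \<le> indicator {u<..v} x * e'"
      proof (cases "x \<in> {u<..v}")
        case True
        then have "x \<in> {u..v}" by simp
        with c have "x \<in> ball c d" by blast
        then have "dist (f c) (f x) < e'"
          using True uv c by (intro d) (auto simp: dist_commute)
        then show ?thesis using True by (simp add: dist_norm)
      qed auto
    qed (auto intro!: integrable_mult_left integrable_real_indicator simp: less_top[symmetric])
    also have "\<dots> = e' * (\<sigma> v - \<sigma> u)"
      using uv \<sigma> by simp
    finally show ?thesis .
  qed
  have "norm ((\<Sum>(x, K)\<in>p. (\<sigma> (Sup K) - \<sigma> (Inf K)) *\<^sub>R f x) - F b) < e"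
    if p: "p tagged_division_of {a..b}" and fine: "(\<lambda>x. ball x d) fine p" for p
  proof -
    have "F a = 0" by (simp add: F_def set_lebesgue_integral_def)
    then have Fb: "F b = (\<Sum>(x, K)\<in>p. F (Sup K) - F (Inf K))"
      using additive_tagged_division_1[OF ab p, of F] by simp
    have "(\<Sum>(x, K)\<in>p. (\<sigma> (Sup K) - \<sigma> (Inf K)) *\<^sub>R f x) - F b =
        (\<Sum>(x, K)\<in>p. (\<sigma> (Sup K) - \<sigma> (Inf K)) *\<^sub>R f x - (F (Sup K) - F (Inf K)))"
      unfolding Fb sum_subtractf[symmetric] by (intro sum.cong) auto
    also have "norm \<dots> \<le> (\<Sum>(x, K)\<in>p. e' * (\<sigma> (Sup K) - \<sigma> (Inf K)))"
    proof (rule sum_norm_le, clarify)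
      fix x K assume xK: "(x, K) \<in> p"
      obtain u v where K: "K = {u..v}"
        using tagged_division_ofD(4)[OF p xK] by (auto simp: cbox_interval)
      have x: "x \<in> K" and sub: "K \<subseteq> {a..b}" and ball: "K \<subseteq> ball x d"
        using tagged_division_ofD(2,3)[OF p xK] fine xK by (auto simp: fine_def)
      then show "norm ((\<sigma> (Sup K) - \<sigma> (Inf K)) *\<^sub>R f x - (F (Sup K) - F (Inf K)))
            \<le> e' * (\<sigma> (Sup K) - \<sigma> (Inf K))"
        using local_bound[of u v x] K by auto
    qed
    also have "\<dots> = e' * (\<Sum>(x, K)\<in>p. \<sigma> (Sup K) - \<sigma> (Inf K))"
      by (simp add: sum_distrib_left case_prod_unfold)
    also have "\<dots> = e' * measure \<mu> {a<..b}"
      using additive_tagged_division_1[OF ab p, of \<sigma>] \<sigma>[of a b] ab by simp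
    also have "\<dots> < e" by (rule e'e)
    finally show ?thesis .
  qed
  then show "\<exists>\<delta>>0. \<forall>p. p tagged_division_of {a..b} \<and> (\<lambda>x. ball x \<delta>) fine p \<longrightarrow>
        norm ((\<Sum>(x, K)\<in>p. (\<sigma> (Sup K) - \<sigma> (Inf K)) *\<^sub>R f x) - (LINT x:{a<..b}|\<mu>. f x)) < e"
    using d(1) unfolding F_def by blast
qed

section \<open>Wiener's lemma for measures without atoms\<close>

lemma cesaro_power_unit_circle:
  fixes z :: complex
  assumes "norm z = 1" "z \<noteq> 1"
  shows "(\<lambda>n. (\<Sum>k<n. z ^ k) / of_nat n) \<longlonglongrightarrow> 0"
proof (rule Lim_null_comparison)
  have "(\<lambda>n. 2 / norm (z - 1) / real n) \<longlonglongrightarrow> 0"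
    by (rule lim_const_over_n)
  then show "(\<lambda>n. 2 / norm (z - 1) / real n) \<longlonglongrightarrow> 0" .
  have "norm ((\<Sum>k<n. z ^ k) / of_nat n) \<le> 2 / norm (z - 1) / real n" for n
  proof -
    have "norm (z ^ n - 1) \<le> 2"
      using norm_triangle_ineq4[of "z ^ n" 1] assms by (simp add: norm_power)
    then show ?thesis
      using assms by (auto simp: geometric_sum norm_divide norm_mult intro!: divide_right_mono)
  qed
  then show "\<forall>\<^sub>F n in sequentially. norm ((\<Sum>k<n. z ^ k) / of_nat n) \<le> 2 / norm (z - 1) / real n"
    by simp
qed

lemma norm_mean_le_1:
  fixes f :: "nat \<Rightarrow> complex"
  assumes "\<And>k. norm (f k) \<le> 1"
  shows "norm ((\<Sum>k<n. f k) / of_nat n) \<le> 1"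
proof -
  have "norm (\<Sum>k<n. f k) \<le> (\<Sum>k<n. 1)"
    using assms by (intro sum_norm_le) auto
  then show ?thesis by (cases "n = 0") (auto simp: norm_divide divide_le_eq_1)
qed

text \<open>
  Squared moduli of Fourier coefficients are Fourier coefficients of the distribution of the
  difference of two independent points \<open>x\<close>, \<open>y\<close>. The Cesaro means of \<open>iexp (k * (x - y))\<close> tend to 0 unless \<open>x - y\<close> is a
  multiple of \<open>2 * pi\<close>; for fixed \<open>x\<close> this excludes only countably many \<open>y\<close>, a null set if there are
  no atoms. As the means are bounded by 1, dominated convergence can be applied in \<open>y\<close> and then in \<open>x\<close>,
  and Fubini is avoided because one factor \<open>char M k\<close> is kept as the result of the inner integral.
\<close>

lemma (in real_distribution) wiener_atomless:
  assumes atomless: "\<And>x. measure M {x} = 0"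
  shows "(\<lambda>n. (\<Sum>k<n. (norm (char M (real k)))\<^sup>2) / real n) \<longlonglongrightarrow> 0"
proof -
  \<comment> \<open>The inner integral, over the second point, with the first point fixed.\<close>
  have inner: "(\<lambda>n. (\<Sum>k<n. cnj (char M (real k)) * iexp (real k * x)) / of_nat n) \<longlonglongrightarrow> 0" for x
  proof -
    have "(\<lambda>n. \<integral>y. (\<Sum>k<n. iexp (x - y) ^ k) / of_nat n \<partial>M) \<longlonglongrightarrow> (\<integral>y. 0 \<partial>M)"
    proof (rule integral_dominated_convergence[where w = "\<lambda>_. 1"])
      have "AE y in M. \<forall>n::int. y \<noteq> x - 2 * of_int n * pi"
        unfolding AE_all_countable
      proof
        fix n :: int
        have "{x - 2 * of_int n * pi} \<in> null_sets M"
          using atomless by (auto simp: null_sets_def emeasure_eq_measure)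
        from AE_not_in[OF this] show "AE y in M. y \<noteq> x - 2 * of_int n * pi"
          by simp
      qed
      then show "AE y in M. (\<lambda>n. (\<Sum>k<n. iexp (x - y) ^ k) / of_nat n) \<longlonglongrightarrow> 0"
      proof eventually_elim
        case (elim y)
        have "iexp (x - y) \<noteq> 1"
        proof
          assume "iexp (x - y) = 1"
          then obtain n :: int where "x - y = of_int (2 * n) * pi"
            by (auto simp: exp_eq_1)
          then have "y = x - 2 * of_int n * pi" by simp
          with elim show False by blast
        qed
        then show ?case by (intro cesaro_power_unit_circle) auto
      qed
      show "AE y in M. norm ((\<Sum>k<n. iexp (x - y) ^ k) / of_nat n) \<le> 1" for n
        by (intro AE_I2 norm_mean_le_1) (simp add: norm_power)
    qed auto
    moreover have "(\<integral>y. (\<Sum>k<n. iexp (x - y) ^ k) / of_nat n \<partial>M) =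
        (\<Sum>k<n. cnj (char M (real k)) * iexp (real k * x)) / of_nat n" for n
    proof -
      have eq: "iexp (x - y) ^ k = cnj (iexp (real k * y)) * iexp (real k * x)" for k y
        by (simp add: exp_of_nat_mult[symmetric] exp_cnj exp_add[symmetric] algebra_simps)
      have int: "integrable M (\<lambda>y. cnj (iexp (real k * y)) * iexp (real k * x))" for k
        by (intro integrable_mult_left integrable_cnj) (auto simp: integrable_iexp)
      have int': "(\<integral>y. cnj (iexp (real k * y)) * iexp (real k * x) \<partial>M) =
          cnj (char M (real k)) * iexp (real k * x)" for k
        unfolding char_def by simp
      show ?thesis
        unfolding eq by (simp only: integral_divide_zero Bochner_Integration.integral_sum int int')
    qed
    ultimately show ?thesis by (simp only: Bochner_Integration.integral_zero)
  qed
  have "(\<lambda>n. \<integral>x. (\<Sum>k<n. cnj (char M (real k)) * iexp (real k * x)) / of_nat n \<partial>M)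
      \<longlonglongrightarrow> (\<integral>x. 0 \<partial>M)"
  proof (rule integral_dominated_convergence[where w = "\<lambda>_. 1"])
    show "AE x in M. norm ((\<Sum>k<n. cnj (char M (real k)) * iexp (real k * x)) / of_nat n) \<le> 1" for n
      by (intro AE_I2 norm_mean_le_1) (simp add: norm_mult cmod_char_le_1)
    show "AE x in M. (\<lambda>n. (\<Sum>k<n. cnj (char M (real k)) * iexp (real k * x)) / of_nat n) \<longlonglongrightarrow> 0"
      by (rule AE_I2) (rule inner)
  qed auto
  moreover have "(\<integral>x. (\<Sum>k<n. cnj (char M (real k)) * iexp (real k * x)) / of_nat n \<partial>M) =
      complex_of_real ((\<Sum>k<n. (norm (char M (real k)))\<^sup>2) / real n)" for n
  proof -
    have int: "integrable M (\<lambda>x. cnj (char M (real k)) * iexp (real k * x))" for k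
      by (intro integrable_mult_right) (auto simp: integrable_iexp)
    have int': "(\<integral>x. cnj (char M (real k)) * iexp (real k * x) \<partial>M) =
        of_real ((norm (char M (real k)))\<^sup>2)" for k
      using complex_norm_square[of "char M (real k)"]
      by (simp add: char_def mult.commute)
    show ?thesis
      by (simp only: integral_divide_zero Bochner_Integration.integral_sum int int'
          of_real_divide of_real_sum of_real_of_nat_eq)
  qed
  ultimately have "(\<lambda>n. complex_of_real ((\<Sum>k<n. (norm (char M (real k)))\<^sup>2) / real n)) \<longlonglongrightarrow> of_real 0"
    by (simp only: Bochner_Integration.integral_zero of_real_0)
  then show ?thesis by (rule tendsto_of_real_iff[THEN iffD1])
qed


section \<open>Herglotz's theorem\<close>

lemma integral_iexp_period:
  "(\<integral>x. indicator {-pi..pi} x *\<^sub>R iexp (of_int m * x) \<partial>lborel) = (if m = 0 then of_real (2 * pi) else 0)"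
proof (cases "m = 0")
  case True
  have "(\<integral>x. indicator {-pi..pi} x *\<^sub>R (1::complex) \<partial>lborel) = of_real pi - of_real (- pi)"
    by (intro integral_FTC_atLeastAtMost)
      (auto simp flip: of_real_minus intro!: derivative_eq_intros continuous_intros
        simp: has_vector_derivative_def fun_eq_iff scaleR_conv_of_real)
  then show ?thesis using True by simp
next
  case False
  define F where "F x = iexp (of_int m * x) / (\<i> * of_int m)" for x :: real
  have "(\<integral>x. indicator {-pi..pi} x *\<^sub>R iexp (of_int m * x) \<partial>lborel) = F pi - F (- pi)"
  proof (rule integral_FTC_atLeastAtMost)
    fix x :: real
    have "((\<lambda>x. exp (\<i> * of_int m * of_real x) / (\<i> * of_int m)) has_vector_derivative
        exp (\<i> * of_int m * of_real x) * (\<i> * of_int m) / (\<i> * of_int m)) (at x within {-pi..pi})"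
      by (auto intro!: derivative_eq_intros has_vector_derivative_real_field)
    then show "(F has_vector_derivative iexp (of_int m * x)) (at x within {-pi..pi})"
      using False by (simp add: F_def[abs_def] mult.assoc)
  qed (auto intro!: continuous_intros)
  also have "F pi - F (- pi) = 0"
  proof -
    have "sin (of_int m * pi) = 0" by (metis sin_integer_2pi sin_times_pi_eq_0 Ints_of_int mult.commute)
    then have "iexp (of_int m * pi) = iexp (of_int m * (- pi))"
      by (simp add: complex_eq_iff Re_exp Im_exp)
    then show ?thesis by (simp only: F_def diff_self)
  qed
  finally show ?thesis using False by simp
qed

text \<open>
  Divided by \<open>n\<close>, the length of the \<open>t\<close>-th diagonal of an \<open>n \<times> n\<close> matrix is the weight that Fejer
  summation gives to the \<open>t\<close>-th Fourier coefficient.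
\<close>

lemma card_diagonal:
  "(\<Sum>j<n. \<Sum>k<n. if int j - int k = t then 1 else 0) = n - nat \<bar>t\<bar>"
proof -
  have *: "(\<Sum>j<n. \<Sum>k<n. if int j - int k = int s then 1 else 0) = n - s" for s
  proof -
    have "(\<Sum>j<n. \<Sum>k<n. if int j - int k = int s then 1 else 0::nat) =
        (\<Sum>k<n. \<Sum>j<n. if j = k + s then 1 else 0)"
      by (subst sum.swap) (auto intro!: sum.cong)
    also have "\<dots> = (\<Sum>k<n. if k + s < n then 1 else 0)"
      by (simp add: sum.delta)
    also have "\<dots> = card ({..<n} \<inter> {k. k + s < n})"
      by (simp add: sum.If_cases)
    also have "{..<n} \<inter> {k. k + s < n} = {..<n - s}" by auto
    finally show ?thesis by simp
  qed
  show ?thesis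
  proof (cases "t \<ge> 0")
    case True
    then show ?thesis using *[of "nat t"] by simp
  next
    case False
    have "(\<Sum>j<n. \<Sum>k<n. if int j - int k = t then 1 else 0::nat) =
        (\<Sum>j<n. \<Sum>k<n. if int j - int k = int (nat (- t)) then 1 else 0)"
      using False by (subst sum.swap) (auto intro!: sum.cong)
    then show ?thesis using *[of "nat (- t)"] False by simp
  qed
qed

text \<open>
  Positive definiteness, applied to the vectors \<open>(iexp (- j * \<theta>))\<close>, says that the Fejer means of the
  Fourier series with coefficients \<open>b\<close> are nonnegative. They are therefore densities of probability
  measures on \<open>[-pi, pi]\<close>, whose Fourier coefficients \<open>(1 - \<bar>t\<bar> / n) * b t\<close> converge to \<open>b t\<close>. As all these
  measures live on one compact interval, Helly's selection theorem provides a weak limit along a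
  subsequence, and this limit has the Fourier coefficients \<open>b\<close>.
\<close>

theorem herglotz:
  fixes b :: "int \<Rightarrow> complex"
  assumes pos: "\<And>N c. (\<Sum>j<N. \<Sum>k<N. c j * cnj (c k) * b (int j - int k)) \<in> \<real>\<^sub>\<ge>\<^sub>0"
    and b0: "b 0 = 1"
  shows "\<exists>\<mu>. real_distribution \<mu> \<and> measure \<mu> {-pi..pi} = 1 \<and> (\<forall>t. char \<mu> (of_int t) = b t)"
proof -
  \<comment> \<open>The Fejer mean of order \<open>n\<close>, with the factor \<open>1 / (2 * pi)\<close> that makes it a density.\<close>
  define D where "D n \<theta> = (\<Sum>j<n. \<Sum>k<n. b (int j - int k) * iexp (of_int (int k - int j) * \<theta>)) / (2 * pi * n)"
    for n :: nat and \<theta> :: real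
  define g where "g n \<theta> = indicator {-pi..pi} \<theta> * Re (D n \<theta>)" for n \<theta>
  have D_real: "of_real (Re (D n \<theta>)) = D n \<theta>" and D_nonneg: "Re (D n \<theta>) \<ge> 0" for n \<theta>
  proof -
    have "(\<Sum>j<n. \<Sum>k<n. b (int j - int k) * iexp (of_int (int k - int j) * \<theta>)) =
      (\<Sum>j<n. \<Sum>k<n. iexp (- real j * \<theta>) * cnj (iexp (- real k * \<theta>)) * b (int j - int k))"
      by (intro sum.cong refl) (simp add: exp_cnj exp_add[symmetric] algebra_simps)
    with pos[where c = "\<lambda>j. iexp (- real j * \<theta>)" and N = n]
    obtain r where "r \<ge> 0" "(\<Sum>j<n. \<Sum>k<n. b (int j - int k) * iexp (of_int (int k - int j) * \<theta>)) = of_real r"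
      unfolding nonneg_Reals_def by auto
    then have "D n \<theta> = of_real (r / (2 * pi * n))" "r / (2 * pi * n) \<ge> 0"
      by (simp_all add: D_def)
    then show "of_real (Re (D n \<theta>)) = D n \<theta>" "Re (D n \<theta>) \<ge> 0" by simp_all
  qed
  have D_cont: "continuous_on S (D n)" for S n
    unfolding D_def divide_inverse by (intro continuous_intros)
  have g_meas [measurable]: "g n \<in> borel_measurable borel" for n
    unfolding g_def using borel_measurable_continuous_onI[OF D_cont, of n] by measurable
  have g_nonneg: "g n \<theta> \<ge> 0" for n \<theta> by (simp add: g_def D_nonneg)
  have g_int: "integrable lborel (g n)" for n
    using borel_integrable_compact[of "{-pi..pi}" "\<lambda>\<theta>. Re (D n \<theta>)"] D_cont
    by (simp add: g_def[abs_def] continuous_on_Re)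
  have fourier: "(\<integral>\<theta>. g n \<theta> *\<^sub>R iexp (of_int t * \<theta>) \<partial>lborel) = of_nat (n - nat \<bar>t\<bar>) / of_nat n * b t" for n t
  proof -
    define E where "E m \<theta> = indicator {-pi..pi} \<theta> *\<^sub>R iexp (of_int m * \<theta>)" for m :: int and \<theta> :: real
    have E_int: "integrable lborel (E m)" for m
      unfolding E_def by (intro borel_integrable_compact continuous_intros) auto
    have E_val: "(\<integral>\<theta>. E m \<theta> \<partial>lborel) = (if m = 0 then of_real (2 * pi) else 0)" for m
      unfolding E_def by (rule integral_iexp_period)
    have "g n \<theta> *\<^sub>R iexp (of_int t * \<theta>) =
        (\<Sum>j<n. \<Sum>k<n. b (int j - int k) * E (t - (int j - int k)) \<theta>) / (2 * pi * n)" for \<theta>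
    proof -
      have "g n \<theta> *\<^sub>R iexp (of_int t * \<theta>) = indicator {-pi..pi} \<theta> *\<^sub>R (D n \<theta> * iexp (of_int t * \<theta>))"
        by (simp add: g_def scaleR_conv_of_real D_real)
      also have "D n \<theta> * iexp (of_int t * \<theta>) =
          (\<Sum>j<n. \<Sum>k<n. b (int j - int k) * iexp (of_int (t - (int j - int k)) * \<theta>)) / (2 * pi * n)"
      proof -
        have "iexp (of_int (int k - int j) * \<theta>) * iexp (of_int t * \<theta>) = iexp (of_int (t - (int j - int k)) * \<theta>)" for j k
          by (simp add: exp_add[symmetric] algebra_simps)
        then show ?thesis
          by (simp only: D_def sum_distrib_right times_divide_eq_left mult.assoc)
      qed
      also have "indicator {-pi..pi} \<theta> *\<^sub>R \<dots> =
          (\<Sum>j<n. \<Sum>k<n. b (int j - int k) * E (t - (int j - int k)) \<theta>) / (2 * pi * n)"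
        by (simp add: E_def indicator_def)
      finally show ?thesis .
    qed
    then have "(\<integral>\<theta>. g n \<theta> *\<^sub>R iexp (of_int t * \<theta>) \<partial>lborel) =
        (\<Sum>j<n. \<Sum>k<n. b (int j - int k) * (\<integral>\<theta>. E (t - (int j - int k)) \<theta> \<partial>lborel)) / (2 * pi * n)"
      by (simp add: E_int)
    also have "\<dots> = (\<Sum>j<n. \<Sum>k<n. (2 * pi * b t) * of_nat (if int j - int k = t then 1 else 0)) / (2 * pi * n)"
      unfolding E_val by (intro arg_cong2[of _ _ _ _ "(/)"] refl sum.cong) auto
    also have "\<dots> = (2 * pi * b t) * of_nat (\<Sum>j<n. \<Sum>k<n. if int j - int k = t then 1 else 0) / (2 * pi * n)"
      by (simp only: of_nat_sum sum_distrib_left)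
    also have "\<dots> = of_nat (n - nat \<bar>t\<bar>) / of_nat n * b t"
      unfolding card_diagonal by simp
    finally show ?thesis .
  qed
  \<comment> \<open>The index is shifted because the Fejer mean of order 0 is identically 0.\<close>
  define \<nu> where "\<nu> n = density lborel (\<lambda>\<theta>. ennreal (g (Suc n) \<theta>))" for n
  have \<nu>_full: "emeasure (\<nu> n) A = 1" if "A \<in> sets borel" "{-pi..pi} \<subseteq> A" for n A
  proof -
    have "emeasure (\<nu> n) A = (\<integral>\<^sup>+\<theta>. ennreal (g (Suc n) \<theta>) * indicator A \<theta> \<partial>lborel)"
      unfolding \<nu>_def using that by (subst emeasure_density) auto
    also have "\<dots> = (\<integral>\<^sup>+\<theta>. ennreal (g (Suc n) \<theta>) \<partial>lborel)"
      using that by (intro nn_integral_cong) (auto simp: g_def indicator_def)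
    also have "\<dots> = ennreal (\<integral>\<theta>. g (Suc n) \<theta> \<partial>lborel)"
      by (intro nn_integral_eq_integral g_int) (simp add: g_nonneg)
    also have "(\<integral>\<theta>. g (Suc n) \<theta> \<partial>lborel) = 1"
    proof -
      have "complex_of_real (\<integral>\<theta>. g (Suc n) \<theta> \<partial>lborel) = (\<integral>\<theta>. g (Suc n) \<theta> *\<^sub>R iexp (of_int 0 * \<theta>) \<partial>lborel)"
        by (simp add: scaleR_conv_of_real)
      also have "\<dots> = of_real 1" unfolding fourier using b0 of_nat_neq_0[where 'a = complex, of n]
        by (simp del: of_nat_Suc)
      finally show ?thesis by (simp only: of_real_eq_iff)
    qed
    finally show ?thesis by simp
  qed
  have \<nu>_distr: "real_distribution (\<nu> n)" for n
  proof -
    have "space (\<nu> n) = UNIV" by (simp add: \<nu>_def)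
    then have "prob_space (\<nu> n)" by (intro prob_spaceI) (simp add: \<nu>_full)
    then show ?thesis
      unfolding real_distribution_def real_distribution_axioms_def by (simp add: \<nu>_def)
  qed
  have \<nu>_char: "char (\<nu> n) (of_int t) = of_nat (Suc n - nat \<bar>t\<bar>) / of_nat (Suc n) * b t" for n t
    unfolding char_def \<nu>_def fourier[symmetric]
    by (subst integral_density) (auto simp: g_nonneg)
  have "tight \<nu>"
    unfolding tight_def
  proof (intro conjI allI impI)
    fix e :: real assume "e > 0"
    have "{-pi..pi} \<subseteq> {-4<..4}" using pi_less_4 by auto
    then have "measure (\<nu> n) {-4<..4} = 1" for n
      by (simp add: measure_def \<nu>_full)
    then show "\<exists>a b. a < b \<and> (\<forall>n. 1 - e < measure (\<nu> n) {a<..b})"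
      using \<open>e > 0\<close> by (intro exI[of _ "-4"] exI[of _ 4]) auto
  qed (rule \<nu>_distr)
  from tight_imp_convergent_subsubsequence[OF this strict_mono_id]
  obtain r \<mu> where r: "strict_mono r" and \<mu>: "real_distribution \<mu>" and "weak_conv_m (\<nu> \<circ> id \<circ> r) \<mu>"
    by blast
  then have "weak_conv_m (\<lambda>n. \<nu> (r n)) \<mu>" by (simp add: comp_def)
  note conv = weak_conv_imp_integral_bdd_continuous_conv[OF \<nu>_distr \<mu> this]
  interpret \<mu>: real_distribution \<mu> by fact
  have "char \<mu> (of_int t) = b t" for t
  proof -
    have "(\<lambda>n. char (\<nu> (r n)) (of_int t)) \<longlonglongrightarrow> char \<mu> (of_int t)"
      unfolding char_def by (rule conv[where B = 1]) auto
    moreover have "(\<lambda>n. char (\<nu> (r n)) (of_int t)) \<longlonglongrightarrow> b t"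
    proof -
      have "(\<lambda>n. real (Suc n - nat \<bar>t\<bar>) / real (Suc n)) \<longlonglongrightarrow> 1"
      proof (rule Lim_transform_eventually)
        have "(\<lambda>n. 1 - real (nat \<bar>t\<bar>) / real (Suc n)) \<longlonglongrightarrow> 1 - 0"
          by (intro tendsto_diff tendsto_const LIMSEQ_Suc lim_const_over_n)
        then show "(\<lambda>n. 1 - real (nat \<bar>t\<bar>) / real (Suc n)) \<longlonglongrightarrow> 1" by simp
        show "\<forall>\<^sub>F n in sequentially. 1 - real (nat \<bar>t\<bar>) / real (Suc n) = real (Suc n - nat \<bar>t\<bar>) / real (Suc n)"
          using eventually_ge_at_top[of "nat \<bar>t\<bar>"]
        proof eventually_elim
          case (elim n)
          then have "real (Suc n - nat \<bar>t\<bar>) = real (Suc n) - real (nat \<bar>t\<bar>)"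
            by (intro of_nat_diff) simp
          then show ?case by (simp only: diff_divide_distrib) simp
        qed
      qed
      from tendsto_mult_right[OF tendsto_of_real[OF LIMSEQ_subseq_LIMSEQ[OF this r]], of "b t"]
      show ?thesis unfolding \<nu>_char by (simp add: comp_def)
    qed
    ultimately show ?thesis by (rule LIMSEQ_unique)
  qed
  \<comment> \<open>The function \<open>h\<close> below is bounded and continuous and vanishes exactly on \<open>[-pi, pi]\<close>; its
    integral therefore passes to the weak limit and detects mass outside the interval.\<close>
  moreover have "measure \<mu> {-pi..pi} = 1"
  proof -
    define h where "h x = min 1 (infdist x {-pi..pi})" for x :: real
    have h_nonneg: "0 \<le> h x" for x by (simp add: h_def infdist_nonneg)
    have h_le: "h x \<le> 1" for x by (simp add: h_def)
    have h_cont: "isCont h x" for x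
      unfolding h_def by (intro continuous_intros)
    have h_meas: "h \<in> borel_measurable borel"
      using h_cont by (intro borel_measurable_continuous_onI continuous_at_imp_continuous_on) auto
    have "(\<integral>x. h x \<partial>\<nu> n) = 0" for n
    proof (rule integral_eq_zero_AE)
      interpret \<nu>: real_distribution "\<nu> n" by (rule \<nu>_distr)
      have "\<nu>.prob {-pi..pi} = 1" by (simp add: measure_def \<nu>_full)
      from \<nu>.AE_prob_1[OF this] show "AE x in \<nu> n. h x = 0"
        by eventually_elim (simp add: h_def)
    qed
    moreover have "(\<lambda>n. \<integral>x. h x \<partial>\<nu> (r n)) \<longlonglongrightarrow> (\<integral>x. h x \<partial>\<mu>)"
      using h_cont h_nonneg h_le by (intro conv[where B = 1]) auto
    ultimately have "(\<integral>x. h x \<partial>\<mu>) = 0" by (simp add: LIMSEQ_const_iff)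
    moreover have "integrable \<mu> h"
      using h_meas h_nonneg h_le by (intro \<mu>.integrable_const_bound[of _ 1]) auto
    ultimately have "AE x in \<mu>. h x = 0"
      using integral_nonneg_eq_0_iff_AE[of \<mu> h] h_nonneg by simp
    then have "AE x in \<mu>. x \<in> {-pi..pi}"
    proof eventually_elim
      case (elim x)
      then have "infdist x {-pi..pi} = 0" by (auto simp: h_def min_def split: if_splits)
      then show ?case
        using in_closed_iff_infdist_zero[of "{-pi..pi}" x] by simp
    qed
    then show ?thesis by (subst \<mu>.prob_eq_1) auto
  qed
  ultimately show ?thesis using \<mu> by blast
qed


section \<open>Spectral measures and spectral distribution functions\<close>

text \<open>
  The increments of \<open>\<sigma>\<close> only see half-open intervals, so an atom at \<open>- pi\<close> would be lost. Hence the
  mass is required to lie in \<open>{-pi<..pi}\<close>.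
\<close>

lemma has_stieltjes_integral_char:
  assumes \<mu>: "real_distribution \<mu>" and full: "measure \<mu> {-pi<..pi} = 1"
    and \<sigma>: "\<And>u v. -pi \<le> u \<Longrightarrow> u \<le> v \<Longrightarrow> v \<le> pi \<Longrightarrow> \<sigma> v - \<sigma> u = measure \<mu> {u<..v}"
  shows "has_stieltjes_integral (\<lambda>\<theta>. exp (\<i> * of_int t * of_real \<theta>)) \<sigma> (-pi) pi (char \<mu> (of_int t))"
proof -
  interpret real_distribution \<mu> by fact
  have "has_stieltjes_integral (\<lambda>\<theta>. exp (\<i> * of_int t * of_real \<theta>)) \<sigma> (-pi) pi
      (LINT \<theta>:{-pi<..pi}|\<mu>. exp (\<i> * of_int t * of_real \<theta>))"
    using \<sigma> by (intro has_stieltjes_integral_measure finite_measure_axioms continuous_intros) auto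
  also have "(LINT \<theta>:{-pi<..pi}|\<mu>. exp (\<i> * of_int t * of_real \<theta>)) = char \<mu> (of_int t)"
    unfolding set_lebesgue_integral_def char_def
  proof (rule integral_cong_AE)
    show "AE \<theta> in \<mu>. indicator {-pi<..pi} \<theta> *\<^sub>R exp (\<i> * of_int t * of_real \<theta>) = iexp (of_int t * \<theta>)"
      using AE_prob_1[OF full] by eventually_elim (simp add: mult.assoc)
  qed auto
  finally show ?thesis .
qed

text \<open>
  Extended by constants, a continuous \<open>\<sigma>\<close> is right-continuous on the whole line and so is the
  distribution function of a Lebesgue--Stieltjes measure, in which points have measure 0. The
  Stieltjes integrals with respect to \<open>\<sigma>\<close> are the Lebesgue integrals with respect to that measure.
\<close>

lemma spectral_measure_of_continuous_distribution_function:
  assumes \<sigma>: "spectral_distribution_function b \<sigma>" and cont: "continuous_on {-pi..pi} \<sigma>"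
  shows "\<exists>\<mu>. real_distribution \<mu> \<and> (\<forall>x. measure \<mu> {x} = 0) \<and> (\<forall>t. char \<mu> (of_int t) = of_real (b t))"
proof -
  define F where "F x = \<sigma> (max (-pi) (min pi x)) - \<sigma> (-pi)" for x
  have F_mono: "F x \<le> F y" if "x \<le> y" for x y
  proof -
    have "mono_on {-pi..pi} \<sigma>" using \<sigma> by (simp add: spectral_distribution_function_def)
    then have "\<sigma> (max (-pi) (min pi x)) \<le> \<sigma> (max (-pi) (min pi y))"
      by (rule mono_onD) (use that in auto)
    then show ?thesis by (simp add: F_def)
  qed
  have F_cont: "continuous_on UNIV F"
    unfolding F_def by (intro continuous_intros continuous_on_compose2[OF cont]) auto
  then have F_isCont: "isCont F x" for x
    by (simp add: continuous_on_eq_continuous_at)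
  then have F_right: "continuous (at_right x) F" for x
    by (rule continuous_at_imp_continuous_at_within)
  have F_bot: "(F \<longlongrightarrow> 0) at_bot"
  proof (rule tendsto_eventually)
    show "\<forall>\<^sub>F x in at_bot. F x = 0"
      using eventually_le_at_bot[of "-pi"] by eventually_elim (simp add: F_def)
  qed
  have F_top: "(F \<longlongrightarrow> 1) at_top"
  proof (rule tendsto_eventually)
    show "\<forall>\<^sub>F x in at_top. F x = 1"
      using eventually_ge_at_top[of pi]
      by eventually_elim (use \<sigma> in \<open>simp add: F_def spectral_distribution_function_def\<close>)
  qed
  define \<mu> where "\<mu> = interval_measure F"
  have \<mu>: "real_distribution \<mu>"
    unfolding \<mu>_def by (intro real_distribution_interval_measure F_mono F_right F_bot F_top)
  interpret real_distribution \<mu> by fact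
  have cdf: "cdf \<mu> = F"
    unfolding \<mu>_def by (intro cdf_interval_measure F_mono F_right F_bot)
  have diff: "\<sigma> v - \<sigma> u = measure \<mu> {u<..v}" if "-pi \<le> u" "u \<le> v" "v \<le> pi" for u v
  proof (cases "u = v")
    case False
    then have "measure \<mu> {u<..v} = F v - F u"
      using that cdf_diff_eq[of u v] by (simp add: cdf)
    moreover have "F w = \<sigma> w - \<sigma> (-pi)" if "-pi \<le> w" "w \<le> pi" for w
      using that by (simp add: F_def min_absorb2 max_absorb2)
    ultimately show ?thesis using that by simp
  qed simp
  have full: "measure \<mu> {-pi<..pi} = 1"
    using diff[of "-pi" pi] \<sigma> by (simp add: spectral_distribution_function_def)
  have "char \<mu> (of_int t) = of_real (b t)" for t
  proof (rule has_stieltjes_integral_unique[of "-pi" pi])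
    show "has_stieltjes_integral (\<lambda>\<theta>. exp (\<i> * of_int t * of_real \<theta>)) \<sigma> (-pi) pi (char \<mu> (of_int t))"
      by (intro has_stieltjes_integral_char \<mu> full diff)
    show "has_stieltjes_integral (\<lambda>\<theta>. exp (\<i> * of_int t * of_real \<theta>)) \<sigma> (-pi) pi (of_real (b t))"
      using \<sigma> by (simp add: spectral_distribution_function_def)
  qed simp
  moreover have "measure \<mu> {x} = 0" for x
    using F_isCont isCont_cdf cdf by simp
  ultimately show ?thesis using \<mu> by blast
qed

text \<open>
  Conversely, let \<open>G\<close> be the distribution function of an atomless spectral measure. Its reflection
  \<open>- G (- \<theta>)\<close> is, up to a constant, the distribution function of the reflected measure, and this has the
  same Fourier coefficients because \<open>b\<close> is real. The average of the two is odd, hence satisfies the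
  symmetry condition on spectral distribution functions.
\<close>

lemma continuous_distribution_function_of_spectral_measure:
  fixes b :: "int \<Rightarrow> real"
  assumes \<mu>: "real_distribution \<mu>" and supp: "measure \<mu> {-pi..pi} = 1"
    and atomless: "\<And>x. measure \<mu> {x} = 0" and char: "\<And>t. char \<mu> (of_int t) = of_real (b t)"
  shows "\<exists>\<sigma>. spectral_distribution_function b \<sigma> \<and> continuous_on {-pi..pi} \<sigma>"
proof -
  interpret real_distribution \<mu> by fact
  define G where "G = cdf \<mu>"
  define \<mu>' where "\<mu>' = distr \<mu> borel uminus"
  define \<sigma> where "\<sigma> \<theta> = (G \<theta> + - G (- \<theta>)) / 2" for \<theta>
  have G_cont: "continuous_on UNIV G"
    using isCont_cdf atomless by (simp add: G_def continuous_on_eq_continuous_at)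
  have ne: "AE x in \<mu>. x \<noteq> a" for a
  proof -
    have "{a} \<in> null_sets \<mu>"
      using atomless by (auto simp: null_sets_def emeasure_eq_measure)
    from AE_not_in[OF this] show ?thesis by simp
  qed
  have diff: "G v - G u = measure \<mu> {u<..v}" if "u \<le> v" for u v
    using that cdf_diff_eq[of u v] by (cases "u = v") (auto simp: G_def)
  have full: "measure \<mu> {-pi<..pi} = 1"
  proof -
    have "AE x in \<mu>. x \<in> {-pi<..pi}"
      using AE_prob_1[OF supp] ne[of "-pi"] by eventually_elim auto
    then show ?thesis by (subst prob_eq_1) auto
  qed
  have \<mu>': "real_distribution \<mu>'" unfolding \<mu>'_def by simp
  \<comment> \<open>Reflection turns \<open>{u<..v}\<close> into an interval closed on the left and open on the right; only the
    absence of atoms makes its measure a difference of values of \<open>G\<close>.\<close>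
  have diff': "- G (- v) - - G (- u) = measure \<mu>' {u<..v}" if "u \<le> v" for u v
  proof -
    have "measure \<mu>' {u<..v} = measure \<mu> (uminus -` {u<..v} \<inter> space \<mu>)"
      unfolding \<mu>'_def by (subst measure_distr) auto
    also have "\<dots> = measure \<mu> {-v<..-u}"
    proof (rule measure_eq_AE)
      show "AE x in \<mu>. x \<in> uminus -` {u<..v} \<inter> space \<mu> \<longleftrightarrow> x \<in> {-v<..-u}"
        using ne[of "-u"] ne[of "-v"] by eventually_elim auto
    qed (auto intro!: measurable_sets_borel[of uminus borel])
    also have "\<dots> = - G (- v) - - G (- u)" using diff[of "-v" "-u"] that by simp
    finally show ?thesis by simp
  qed
  have G_ends: "G pi - G (- pi) = 1" using diff[of "-pi" pi] full by simp
  have full': "measure \<mu>' {-pi<..pi} = 1" using diff'[of "-pi" pi] G_ends by simp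
  have even: "b (- t) = b t" for t
  proof -
    have "char \<mu> (of_int (- t)) = (\<integral>x. cnj (iexp (of_int t * x)) \<partial>\<mu>)"
      unfolding char_def by (intro Bochner_Integration.integral_cong) (simp_all add: exp_cnj)
    also have "\<dots> = cnj (char \<mu> (of_int t))"
      unfolding char_def by simp
    finally have "char \<mu> (of_int (- t)) = cnj (char \<mu> (of_int t))" .
    then show ?thesis unfolding char by simp
  qed
  have char': "char \<mu>' (of_int t) = of_real (b t)" for t
  proof -
    have "char \<mu>' (of_int t) = char \<mu> (of_int (- t))"
      unfolding char_def \<mu>'_def by (subst integral_distr) auto
    then show ?thesis unfolding char even .
  qed
  have stieltjes: "has_stieltjes_integral (\<lambda>\<theta>. exp (\<i> * of_int t * of_real \<theta>)) \<sigma> (-pi) pi (of_real (b t))" for t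
  proof -
    have "has_stieltjes_integral (\<lambda>\<theta>. exp (\<i> * of_int t * of_real \<theta>)) G (-pi) pi (of_real (b t))"
      using has_stieltjes_integral_char[OF \<mu> full diff] char by simp
    moreover have "has_stieltjes_integral (\<lambda>\<theta>. exp (\<i> * of_int t * of_real \<theta>)) (\<lambda>\<theta>. - G (- \<theta>)) (-pi) pi (of_real (b t))"
      using has_stieltjes_integral_char[OF \<mu>' full' diff'] char' by simp
    ultimately show ?thesis
      unfolding \<sigma>_def using has_stieltjes_integral_average by fastforce
  qed
  have \<sigma>_cont: "continuous_on {-pi..pi} \<sigma>"
    unfolding \<sigma>_def
    by (intro continuous_intros continuous_on_compose2[OF G_cont]) auto
  have \<sigma>_bounded: "bounded (\<sigma> ` {-pi..pi})"
    using compact_continuous_image[OF \<sigma>_cont] by (auto intro: compact_imp_bounded)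
  have \<sigma>_mono: "mono_on {-pi..pi} \<sigma>"
  proof (rule mono_onI)
    fix x y :: real assume "x \<le> y"
    then have "G x \<le> G y" "G (- y) \<le> G (- x)" by (auto simp: G_def cdf_nondecreasing)
    then show "\<sigma> x \<le> \<sigma> y" by (simp add: \<sigma>_def)
  qed
  have \<sigma>_ends: "\<sigma> pi - \<sigma> (- pi) = 1" using G_ends by (simp add: \<sigma>_def field_simps)
  have b0: "b 0 = 1" using char[of 0] char_zero by simp
  have odd: "\<sigma> (- \<theta>) = - \<sigma> \<theta>" for \<theta> by (simp add: \<sigma>_def field_simps)
  have "spectral_distribution_function b \<sigma>"
    unfolding spectral_distribution_function_def
    using \<sigma>_mono \<sigma>_bounded \<sigma>_ends b0 odd stieltjes by simp
  with \<sigma>_cont show ?thesis by blast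
qed


section \<open>The operator norm of positive semidefinite matrices\<close>

lemma hilbert_norm_vec_eq_L2_set:
  "hilbert_norm_vec v = L2_set (\<lambda>i. cmod (vec_index v i)) {..<dim_vec v}"
proof -
  have "Re (v \<bullet>c v) = (\<Sum>i<dim_vec v. (cmod (vec_index v i))\<^sup>2)"
    by (simp add: scalar_prod_def lessThan_atLeast0 complex_mult_cnj cmod_power2)
  then show ?thesis by (simp add: hilbert_norm_vec_def L2_set_def)
qed

lemma hilbert_norm_vec_nonneg: "0 \<le> hilbert_norm_vec v"
  by (simp add: hilbert_norm_vec_eq_L2_set)

lemma hilbert_norm_vec_power2:
  "(hilbert_norm_vec v)\<^sup>2 = (\<Sum>i<dim_vec v. (cmod (vec_index v i))\<^sup>2)"
  by (simp add: hilbert_norm_vec_eq_L2_set L2_set_def sum_nonneg)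

lemma cscalar_prod_self: "v \<bullet>c v = of_real ((hilbert_norm_vec v)\<^sup>2)"
  by (simp add: scalar_prod_def lessThan_atLeast0 hilbert_norm_vec_power2 complex_norm_square
      del: of_real_power)

lemma hilbert_norm_vec_eq_0_iff: "hilbert_norm_vec v = 0 \<longleftrightarrow> v = 0\<^sub>v (dim_vec v)"
  unfolding hilbert_norm_vec_eq_L2_set by (auto simp: L2_set_eq_0_iff vec_eq_iff)

lemma hilbert_norm_vec_smult: "hilbert_norm_vec (k \<cdot>\<^sub>v v) = cmod k * hilbert_norm_vec v"
proof -
  have "L2_set (\<lambda>i. cmod (vec_index (k \<cdot>\<^sub>v v) i)) {..<dim_vec v} =
      L2_set (\<lambda>i. cmod k * cmod (vec_index v i)) {..<dim_vec v}"
    by (intro L2_set_cong) (auto simp: norm_mult)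
  then show ?thesis by (simp add: hilbert_norm_vec_eq_L2_set L2_set_right_distrib)
qed

lemma cscalar_prod_le:
  assumes "v \<in> carrier_vec n" "w \<in> carrier_vec n"
  shows "cmod (v \<bullet>c w) \<le> hilbert_norm_vec v * hilbert_norm_vec w"
proof -
  have "cmod (v \<bullet>c w) \<le> (\<Sum>i<n. \<bar>cmod (vec_index v i)\<bar> * \<bar>cmod (vec_index w i)\<bar>)"
    using assms by (auto simp: scalar_prod_def lessThan_atLeast0 norm_mult intro!: sum_norm_le)
  also have "\<dots> \<le> hilbert_norm_vec v * hilbert_norm_vec w"
    using L2_set_mult_ineq[of "\<lambda>i. cmod (vec_index v i)" "\<lambda>i. cmod (vec_index w i)" "{..<n}"] assms
    by (simp add: hilbert_norm_vec_eq_L2_set carrier_vecD)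
  finally show ?thesis .
qed

lemma hilbert_norm_vec_diff_smult_power2:
  assumes "v \<in> carrier_vec n" "w \<in> carrier_vec n"
  shows "(hilbert_norm_vec (v - of_real c \<cdot>\<^sub>v w))\<^sup>2 =
    (hilbert_norm_vec v)\<^sup>2 - 2 * c * Re (v \<bullet>c w) + c\<^sup>2 * (hilbert_norm_vec w)\<^sup>2"
proof -
  have eq: "(cmod (x - of_real c * y))\<^sup>2 = (cmod x)\<^sup>2 - 2 * c * Re (x * cnj y) + c\<^sup>2 * (cmod y)\<^sup>2" for x y
    unfolding cmod_power2 by (simp add: power2_eq_square algebra_simps)
  have "(hilbert_norm_vec (v - of_real c \<cdot>\<^sub>v w))\<^sup>2 =
      (\<Sum>i<n. (cmod (vec_index v i - of_real c * vec_index w i))\<^sup>2)"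
    using assms by (auto simp: hilbert_norm_vec_power2 carrier_vecD intro!: sum.cong)
  also have "\<dots> = (\<Sum>i<n. (cmod (vec_index v i))\<^sup>2) - 2 * c * (\<Sum>i<n. Re (vec_index v i * cnj (vec_index w i)))
      + c\<^sup>2 * (\<Sum>i<n. (cmod (vec_index w i))\<^sup>2)"
    unfolding eq by (simp only: sum.distrib sum_subtractf sum_distrib_left)
  also have "(\<Sum>i<n. Re (vec_index v i * cnj (vec_index w i))) = Re (v \<bullet>c w)"
    using assms by (simp add: scalar_prod_def lessThan_atLeast0 carrier_vecD)
  finally show ?thesis using assms by (simp add: hilbert_norm_vec_power2 carrier_vecD)
qed

lemma mult_mat_vec_index_sum:
  assumes "A \<in> carrier_mat n n" "v \<in> carrier_vec n" "i < n"
  shows "vec_index (A *\<^sub>v v) i = (\<Sum>j<n. A $$ (i, j) * vec_index v j)"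
  using assms by (auto simp: scalar_prod_def lessThan_atLeast0 intro!: sum.cong)

lemma hilbert_norm_mult_mat_vec_le:
  assumes A: "A \<in> carrier_mat n n" and v: "v \<in> carrier_vec n"
  shows "hilbert_norm_vec (A *\<^sub>v v) \<le> sqrt (\<Sum>i<n. \<Sum>j<n. (cmod (A $$ (i, j)))\<^sup>2) * hilbert_norm_vec v"
proof (rule power2_le_imp_le)
  have "(hilbert_norm_vec (A *\<^sub>v v))\<^sup>2 = (\<Sum>i<n. (cmod (\<Sum>j<n. A $$ (i, j) * vec_index v j))\<^sup>2)"
    using A v by (auto simp: hilbert_norm_vec_power2 mult_mat_vec_index_sum[OF A v] simp del: index_mult_mat_vec
        intro!: sum.cong)
  also have "\<dots> \<le> (\<Sum>i<n. (\<Sum>j<n. (cmod (A $$ (i, j)))\<^sup>2) * (\<Sum>j<n. (cmod (vec_index v j))\<^sup>2))"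
  proof (rule sum_mono)
    fix i
    have "cmod (\<Sum>j<n. A $$ (i, j) * vec_index v j) \<le> (\<Sum>j<n. cmod (A $$ (i, j)) * cmod (vec_index v j))"
      by (intro sum_norm_le) (simp add: norm_mult)
    then have "(cmod (\<Sum>j<n. A $$ (i, j) * vec_index v j))\<^sup>2 \<le> (\<Sum>j<n. cmod (A $$ (i, j)) * cmod (vec_index v j))\<^sup>2"
      by (intro power_mono) auto
    also have "\<dots> \<le> (\<Sum>j<n. (cmod (A $$ (i, j)))\<^sup>2) * (\<Sum>j<n. (cmod (vec_index v j))\<^sup>2)"
      by (rule Cauchy_Schwarz_ineq_sum)
    finally show "(cmod (\<Sum>j<n. A $$ (i, j) * vec_index v j))\<^sup>2 \<le> \<dots>" .
  qed
  also have "\<dots> = (sqrt (\<Sum>i<n. \<Sum>j<n. (cmod (A $$ (i, j)))\<^sup>2) * hilbert_norm_vec v)\<^sup>2"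
    using v by (simp add: power_mult_distrib sum_nonneg sum_distrib_right hilbert_norm_vec_power2 carrier_vecD)
  finally show "(hilbert_norm_vec (A *\<^sub>v v))\<^sup>2 \<le> \<dots>" .
qed (simp add: hilbert_norm_vec_nonneg sum_nonneg)

lemma hilbert_norm_mat_bdd_above:
  assumes "A \<in> carrier_mat n n"
  shows "bdd_above {hilbert_norm_vec (A *\<^sub>v v) |v. v \<in> carrier_vec (dim_col A) \<and> hilbert_norm_vec v \<le> 1}"
proof (rule bdd_aboveI, clarify)
  fix v assume v: "v \<in> carrier_vec (dim_col A)" "hilbert_norm_vec v \<le> 1"
  let ?s = "sqrt (\<Sum>i<n. \<Sum>j<n. (cmod (A $$ (i, j)))\<^sup>2)"
  have "?s * hilbert_norm_vec v \<le> ?s * 1"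
    using v by (intro mult_left_mono) (auto simp: sum_nonneg)
  then show "hilbert_norm_vec (A *\<^sub>v v) \<le> ?s"
    using hilbert_norm_mult_mat_vec_le[OF assms, of v] v assms by auto
qed

lemma hilbert_norm_mat_le_hilbert_schmidt:
  assumes A: "A \<in> carrier_mat n n"
  shows "hilbert_norm_mat A \<le> sqrt (\<Sum>i<n. \<Sum>j<n. (cmod (A $$ (i, j)))\<^sup>2)"
  unfolding hilbert_norm_mat_def
proof (rule cSup_least)
  have "0\<^sub>v n \<in> carrier_vec (dim_col A) \<and> hilbert_norm_vec (0\<^sub>v n) \<le> 1"
    using A by (simp add: hilbert_norm_vec_eq_L2_set L2_set_def)
  then show "{hilbert_norm_vec (A *\<^sub>v v) |v. v \<in> carrier_vec (dim_col A) \<and> hilbert_norm_vec v \<le> 1} \<noteq> {}"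
    by blast
  fix x assume "x \<in> {hilbert_norm_vec (A *\<^sub>v v) |v. v \<in> carrier_vec (dim_col A) \<and> hilbert_norm_vec v \<le> 1}"
  then obtain v where v: "x = hilbert_norm_vec (A *\<^sub>v v)" "v \<in> carrier_vec n" "hilbert_norm_vec v \<le> 1"
    using A by auto
  let ?s = "sqrt (\<Sum>i<n. \<Sum>j<n. (cmod (A $$ (i, j)))\<^sup>2)"
  have "?s * hilbert_norm_vec v \<le> ?s * 1"
    using v by (intro mult_left_mono) (auto simp: sum_nonneg)
  then show "x \<le> ?s"
    using hilbert_norm_mult_mat_vec_le[OF A v(2)] v by auto
qed

lemma hilbert_norm_mult_mat_vec_le_hilbert_norm_mat:
  assumes A: "A \<in> carrier_mat n n" and v: "v \<in> carrier_vec n"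
  shows "hilbert_norm_vec (A *\<^sub>v v) \<le> hilbert_norm_mat A * hilbert_norm_vec v"
proof (cases "hilbert_norm_vec v = 0")
  case True
  then show ?thesis using hilbert_norm_mult_mat_vec_le[OF A v] by simp
next
  case False
  define r where "r = hilbert_norm_vec v"
  have r: "r > 0" using False hilbert_norm_vec_nonneg[of v] by (simp add: r_def)
  define u where "u = of_real (1 / r) \<cdot>\<^sub>v v"
  have u: "u \<in> carrier_vec n" "hilbert_norm_vec u \<le> 1"
    using v r by (simp_all add: u_def hilbert_norm_vec_smult norm_divide r_def[symmetric])
  have "hilbert_norm_vec (A *\<^sub>v u) \<le> hilbert_norm_mat A"
    unfolding hilbert_norm_mat_def using A u
    by (intro cSup_upper hilbert_norm_mat_bdd_above[OF A]) auto
  moreover have "hilbert_norm_vec (A *\<^sub>v u) = hilbert_norm_vec (A *\<^sub>v v) / r"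
    unfolding u_def mult_mat_vec[OF A v] hilbert_norm_vec_smult using r by (simp add: norm_divide)
  ultimately show ?thesis using r by (simp add: r_def field_simps)
qed

text \<open>
  The unit ball is compact. Vectors of a dimension \<open>n\<close> that is not a type are represented by sequences
  that vanish from index \<open>n\<close> on, so that the compactness comes from the product topology.
\<close>

lemma hilbert_norm_mat_attained:
  assumes A: "A \<in> carrier_mat n n"
  shows "\<exists>v\<in>carrier_vec n. hilbert_norm_vec v \<le> 1 \<and> hilbert_norm_vec (A *\<^sub>v v) = hilbert_norm_mat A"
proof -
  \<comment> \<open>The bound \<open>cball 0 1\<close> on each coordinate follows from the bound on the sum; it is included to
    exhibit the ball as a closed subset of a product of compact sets.\<close>
  define K :: "(nat \<Rightarrow> complex) set" where
    "K = (\<Pi>\<^sub>E i\<in>UNIV. if i < n then cball 0 1 else {0}) \<inter> {f. (\<Sum>i<n. (cmod (f i))\<^sup>2) \<le> 1}"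
  define h where "h f = (\<Sum>i<n. (cmod (\<Sum>j<n. A $$ (i, j) * f j))\<^sup>2)" for f :: "nat \<Rightarrow> complex"
  have "compact (\<Pi>\<^sub>E i\<in>UNIV. if i < n then cball 0 1 else {0::complex})"
    unfolding compactin_euclidean_iff[symmetric] euclidean_product_topology[symmetric] compactin_PiE
    by auto
  moreover have "closed {f :: nat \<Rightarrow> complex. (\<Sum>i<n. (cmod (f i))\<^sup>2) \<le> 1}"
    by (intro closed_Collect_le continuous_intros) auto
  ultimately have "compact K" unfolding K_def by (rule compact_Int_closed)
  moreover have "(\<lambda>_. 0) \<in> K"
    by (auto simp: K_def)
  then have "K \<noteq> {}" by blast
  moreover have "continuous_on K h"
    unfolding h_def by (intro continuous_intros continuous_on_subset[OF continuous_on_product_coordinates]) auto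
  ultimately obtain f where f: "f \<in> K" "\<And>g. g \<in> K \<Longrightarrow> h g \<le> h f"
    using continuous_attains_sup[of K h] by blast
  have h: "h f = (hilbert_norm_vec (A *\<^sub>v vec n f))\<^sup>2" for f
    using A by (auto simp: h_def hilbert_norm_vec_power2 mult_mat_vec_index_sum[OF A] simp del: index_mult_mat_vec
        intro!: sum.cong)
  have n1: "hilbert_norm_vec (vec n g) \<le> 1 \<longleftrightarrow> (\<Sum>i<n. (cmod (g i))\<^sup>2) \<le> 1" for g
    by (simp add: hilbert_norm_vec_eq_L2_set L2_set_def)
  show ?thesis
  proof (intro bexI conjI)
    show "hilbert_norm_vec (vec n f) \<le> 1" using f n1 by (simp add: K_def)
    show "hilbert_norm_vec (A *\<^sub>v vec n f) = hilbert_norm_mat A"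
      unfolding hilbert_norm_mat_def
    proof (rule cSup_eq_maximum[symmetric])
      show "hilbert_norm_vec (A *\<^sub>v vec n f) \<in>
        {hilbert_norm_vec (A *\<^sub>v v) |v. v \<in> carrier_vec (dim_col A) \<and> hilbert_norm_vec v \<le> 1}"
        using \<open>hilbert_norm_vec (vec n f) \<le> 1\<close> A by auto
      fix x assume "x \<in> {hilbert_norm_vec (A *\<^sub>v v) |v. v \<in> carrier_vec (dim_col A) \<and> hilbert_norm_vec v \<le> 1}"
      then obtain v where v: "x = hilbert_norm_vec (A *\<^sub>v v)" "v \<in> carrier_vec n" "hilbert_norm_vec v \<le> 1"
        using A by auto
      define g where "g i = (if i < n then vec_index v i else 0)" for i
      have vg: "v = vec n g" using v by (auto simp: g_def)
      have s: "(\<Sum>i<n. (cmod (g i))\<^sup>2) \<le> 1" using v n1 vg by simp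
      have "(cmod (g i))\<^sup>2 \<le> 1" if "i < n" for i
        using member_le_sum[of i "{..<n}" "\<lambda>i. (cmod (g i))\<^sup>2"] that s by auto
      then have "cmod (g i) \<le> 1" if "i < n" for i
        using that by (simp add: power_le_one_iff)
      then have "g \<in> K" using s by (auto simp: K_def g_def)
      then have "h g \<le> h f" by (rule f)
      then show "x \<le> hilbert_norm_vec (A *\<^sub>v vec n f)"
        unfolding v vg h by (rule power2_le_imp_le) (rule hilbert_norm_vec_nonneg)
    qed
  qed auto
qed

lemma self_adjoint_cscalar_prod:
  assumes A: "A \<in> carrier_mat n n"
    and herm: "\<And>i j. i < n \<Longrightarrow> j < n \<Longrightarrow> A $$ (i, j) = cnj (A $$ (j, i))"
    and v: "v \<in> carrier_vec n" and w: "w \<in> carrier_vec n"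
  shows "(A *\<^sub>v v) \<bullet>c w = v \<bullet>c (A *\<^sub>v w)"
proof -
  have "(A *\<^sub>v v) \<bullet>c w = (\<Sum>i<n. vec_index (A *\<^sub>v v) i * cnj (vec_index w i))"
    using A v w by (simp add: scalar_prod_def lessThan_atLeast0 carrier_vecD)
  also have "\<dots> = (\<Sum>i<n. \<Sum>j<n. A $$ (i, j) * vec_index v j * cnj (vec_index w i))"
    by (simp add: mult_mat_vec_index_sum[OF A v] sum_distrib_right del: index_mult_mat_vec)
  also have "\<dots> = (\<Sum>j<n. \<Sum>i<n. vec_index v j * cnj (A $$ (j, i) * vec_index w i))"
  proof (subst sum.swap, intro sum.cong refl)
    fix i j assume "j \<in> {..<n}" "i \<in> {..<n}"
    then show "A $$ (i, j) * vec_index v j * cnj (vec_index w i) = vec_index v j * cnj (A $$ (j, i) * vec_index w i)"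
      using herm[of i j] by simp
  qed
  also have "\<dots> = (\<Sum>j<n. vec_index v j * cnj (vec_index (A *\<^sub>v w) j))"
    by (simp add: mult_mat_vec_index_sum[OF A w] sum_distrib_left del: index_mult_mat_vec)
  also have "\<dots> = v \<bullet>c (A *\<^sub>v w)"
    using A v w by (simp add: scalar_prod_def lessThan_atLeast0 carrier_vecD)
  finally show ?thesis .
qed

text \<open>
  Let the unit vector \<open>v\<close> maximise \<open>|A v|\<close> and let \<open>\<mu>\<close> be the maximum. Self-adjointness gives
  \<open>\<langle>A A v, v\<rangle> = \<mu>\<^sup>2\<close>, while \<open>|A A v| \<le> \<mu>\<^sup>2\<close>; this is equality in the Cauchy--Schwarz inequality, so
  \<open>A A v = \<mu>\<^sup>2 v\<close>. Then \<open>u = A v + \<mu> v\<close> satisfies \<open>A u = \<mu> u\<close>, and \<open>u\<close> is not 0, since otherwise \<open>- \<mu>\<close>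
  would be a negative value of the quadratic form. If the maximum is 0, every vector is an
  eigenvector.
\<close>

lemma hilbert_norm_mat_eigenvalue:
  assumes A: "A \<in> carrier_mat n n" and n: "n > 0"
    and herm: "\<And>i j. i < n \<Longrightarrow> j < n \<Longrightarrow> A $$ (i, j) = cnj (A $$ (j, i))"
    and psd: "\<And>v. v \<in> carrier_vec n \<Longrightarrow> 0 \<le> Re ((A *\<^sub>v v) \<bullet>c v)"
  shows "eigenvalue A (of_real (hilbert_norm_mat A))"
proof -
  define \<mu> where "\<mu> = hilbert_norm_mat A"
  have eigenI: "eigenvalue A (of_real \<mu>)"
    if "v \<in> carrier_vec n" "v \<noteq> 0\<^sub>v n" "A *\<^sub>v v = of_real \<mu> \<cdot>\<^sub>v v" for v
    using that A unfolding eigenvalue_def eigenvector_def by auto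
  obtain v where v: "v \<in> carrier_vec n" "hilbert_norm_vec v \<le> 1" "hilbert_norm_vec (A *\<^sub>v v) = \<mu>"
    using hilbert_norm_mat_attained[OF A] unfolding \<mu>_def by blast
  have \<mu>0: "\<mu> \<ge> 0" using v hilbert_norm_vec_nonneg by metis
  show ?thesis
  proof (cases "\<mu> = 0")
    case True
    have u: "unit_vec n 0 \<in> carrier_vec n" "unit_vec n 0 \<noteq> (0\<^sub>v n :: complex vec)"
      using n by (auto simp: unit_vec_def vec_eq_iff intro!: exI[of _ 0])
    have "hilbert_norm_vec (A *\<^sub>v unit_vec n 0) \<le> 0"
      using hilbert_norm_mult_mat_vec_le_hilbert_norm_mat[OF A u(1)] True by (simp add: \<mu>_def)
    then have "A *\<^sub>v unit_vec n 0 = 0\<^sub>v n"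
      using hilbert_norm_vec_nonneg[of "A *\<^sub>v unit_vec n 0"] hilbert_norm_vec_eq_0_iff[of "A *\<^sub>v unit_vec n 0"] A
      by auto
    then have "A *\<^sub>v unit_vec n 0 = of_real \<mu> \<cdot>\<^sub>v unit_vec n 0"
      using True by auto
    with u show ?thesis using eigenI unfolding \<mu>_def by blast
  next
    case False
    then have \<mu>: "\<mu> > 0" using \<mu>0 by simp
    define w where "w = A *\<^sub>v v"
    have w: "w \<in> carrier_vec n" and Aw: "A *\<^sub>v w \<in> carrier_vec n" using A v by (auto simp: w_def intro!: mult_mat_vec_carrier)
    have nw: "hilbert_norm_vec w = \<mu>" using v by (simp add: w_def)
    have "\<mu> \<le> \<mu> * hilbert_norm_vec v"
      using hilbert_norm_mult_mat_vec_le_hilbert_norm_mat[OF A v(1)] v(3) by (simp add: \<mu>_def)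
    then have nv: "hilbert_norm_vec v = 1" using v(2) \<mu> by simp
    have "(A *\<^sub>v w) \<bullet>c v = w \<bullet>c w"
      using self_adjoint_cscalar_prod[OF A herm w v(1)] by (simp add: w_def)
    then have ip: "Re ((A *\<^sub>v w) \<bullet>c v) = \<mu>\<^sup>2"
      by (simp add: cscalar_prod_self nw)
    have "hilbert_norm_vec (A *\<^sub>v w) \<le> \<mu>\<^sup>2"
      using hilbert_norm_mult_mat_vec_le_hilbert_norm_mat[OF A w] nw by (simp add: \<mu>_def power2_eq_square)
    then have "(hilbert_norm_vec (A *\<^sub>v w))\<^sup>2 \<le> (\<mu>\<^sup>2)\<^sup>2"
      by (intro power_mono hilbert_norm_vec_nonneg)
    moreover have "(hilbert_norm_vec (A *\<^sub>v w - of_real (\<mu>\<^sup>2) \<cdot>\<^sub>v v))\<^sup>2 = (hilbert_norm_vec (A *\<^sub>v w))\<^sup>2 - (\<mu>\<^sup>2)\<^sup>2"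
      unfolding hilbert_norm_vec_diff_smult_power2[OF Aw v(1)] ip nv by (simp add: power2_eq_square)
    ultimately have "(hilbert_norm_vec (A *\<^sub>v w - of_real (\<mu>\<^sup>2) \<cdot>\<^sub>v v))\<^sup>2 \<le> 0"
      by linarith
    then have "hilbert_norm_vec (A *\<^sub>v w - of_real (\<mu>\<^sup>2) \<cdot>\<^sub>v v) = 0"
      by simp
    then have "A *\<^sub>v w - of_real (\<mu>\<^sup>2) \<cdot>\<^sub>v v = 0\<^sub>v n"
      using Aw v(1) by (simp add: hilbert_norm_vec_eq_0_iff)
    then have AAv: "A *\<^sub>v w = of_real (\<mu>\<^sup>2) \<cdot>\<^sub>v v"
      using A Aw v(1) by (auto simp: vec_eq_iff)
    define u where "u = w + of_real \<mu> \<cdot>\<^sub>v v"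
    have u: "u \<in> carrier_vec n" using w v by (simp add: u_def)
    have Au: "A *\<^sub>v u = of_real \<mu> \<cdot>\<^sub>v u"
    proof -
      have "A *\<^sub>v u = of_real (\<mu>\<^sup>2) \<cdot>\<^sub>v v + of_real \<mu> \<cdot>\<^sub>v w"
        unfolding u_def using A w v(1) AAv
        by (simp add: mult_add_distrib_mat_vec[of _ n n] mult_mat_vec[of _ n n] w_def)
      also have "\<dots> = of_real \<mu> \<cdot>\<^sub>v u"
        using w v(1) by (auto simp: u_def power2_eq_square algebra_simps)
      finally show ?thesis .
    qed
    have "u \<noteq> 0\<^sub>v n"
    proof
      assume "u = 0\<^sub>v n"
      then have wv: "w = of_real (- \<mu>) \<cdot>\<^sub>v v"
        using w v(1) by (auto simp: u_def vec_eq_iff eq_neg_iff_add_eq_0)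
      have "Re ((A *\<^sub>v v) \<bullet>c v) = - \<mu>"
        using v(1) wv nv by (simp add: w_def[symmetric] cscalar_prod_self)
      then show False using psd[OF v(1)] \<mu> by simp
    qed
    then show ?thesis using eigenI[OF u _ Au] by (simp add: \<mu>_def)
  qed
qed

lemma max_eigenvalue_eq_hilbert_norm_mat:
  assumes A: "A \<in> carrier_mat n n" and n: "n > 0"
    and herm: "\<And>i j. i < n \<Longrightarrow> j < n \<Longrightarrow> A $$ (i, j) = cnj (A $$ (j, i))"
    and psd: "\<And>v. v \<in> carrier_vec n \<Longrightarrow> 0 \<le> Re ((A *\<^sub>v v) \<bullet>c v)"
  shows "max_eigenvalue A = hilbert_norm_mat A"
  unfolding max_eigenvalue_def
proof (rule Max_eqI)
  have fin: "finite {k. eigenvalue A k}"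
    unfolding eigenvalue_root_char_poly[OF A] using degree_monic_char_poly[OF A]
    by (intro poly_roots_finite) auto
  show "finite {r. eigenvalue A (complex_of_real r)}"
    using finite_vimageI[OF fin, of complex_of_real] by (simp add: vimage_def inj_on_def)
  show "hilbert_norm_mat A \<in> {r. eigenvalue A (complex_of_real r)}"
    using hilbert_norm_mat_eigenvalue[OF assms] by simp
  fix r assume "r \<in> {r. eigenvalue A (complex_of_real r)}"
  then obtain v where v: "v \<in> carrier_vec n" "v \<noteq> 0\<^sub>v n" "A *\<^sub>v v = of_real r \<cdot>\<^sub>v v"
    using A unfolding eigenvalue_def eigenvector_def by auto
  have "hilbert_norm_vec v \<noteq> 0" using v by (simp add: hilbert_norm_vec_eq_0_iff)
  then have pos: "hilbert_norm_vec v > 0" using hilbert_norm_vec_nonneg[of v] by simp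
  have "\<bar>r\<bar> * hilbert_norm_vec v \<le> hilbert_norm_mat A * hilbert_norm_vec v"
    using hilbert_norm_mult_mat_vec_le_hilbert_norm_mat[OF A v(1)] v(3) by (simp add: hilbert_norm_vec_smult)
  with pos show "r \<le> hilbert_norm_mat A" by simp
qed


section \<open>Norms of correlation matrices\<close>

lemma correlation_matrix_carrier: "correlation_matrix b N \<in> carrier_mat N N"
  by (simp add: correlation_matrix_def)

lemma correlation_matrix_index:
  "i < N \<Longrightarrow> j < N \<Longrightarrow> correlation_matrix b N $$ (i, j) = of_real (b (int i - int j))"
  by (simp add: correlation_matrix_def)

text \<open>
  The coefficients are written as \<open>c j * cnj (c k)\<close> with \<open>c = cnj v\<close>, the shape in which positive
  definiteness of \<open>b\<close> is expressed.
\<close>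

lemma correlation_matrix_quadratic_form:
  assumes v: "v \<in> carrier_vec N"
  shows "(correlation_matrix b N *\<^sub>v v) \<bullet>c v =
    (\<Sum>j<N. \<Sum>k<N. cnj (vec_index v j) * cnj (cnj (vec_index v k)) * of_real (b (int j - int k)))"
proof -
  have "(correlation_matrix b N *\<^sub>v v) \<bullet>c v =
      (\<Sum>j<N. vec_index (correlation_matrix b N *\<^sub>v v) j * cnj (vec_index v j))"
    using v by (simp add: scalar_prod_def lessThan_atLeast0 carrier_vecD)
  also have "\<dots> = (\<Sum>j<N. \<Sum>k<N. cnj (vec_index v j) * cnj (cnj (vec_index v k)) * of_real (b (int j - int k)))"
  proof (intro sum.cong refl)
    fix j assume "j \<in> {..<N}"
    then have j: "j < N" by simp
    show "vec_index (correlation_matrix b N *\<^sub>v v) j * cnj (vec_index v j) =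
        (\<Sum>k<N. cnj (vec_index v j) * cnj (cnj (vec_index v k)) * of_real (b (int j - int k)))"
      unfolding mult_mat_vec_index_sum[OF correlation_matrix_carrier v j] sum_distrib_right
      using j by (intro sum.cong) (auto simp: correlation_matrix_index)
  qed
  finally show ?thesis .
qed

text \<open>
  In each row the entries to the left and to the right of the diagonal are among \<open>h 0, \<dots>, h (N - 1)\<close>.
\<close>

lemma sum_toeplitz_le:
  fixes h :: "int \<Rightarrow> real"
  assumes nonneg: "\<And>t. 0 \<le> h t" and even: "\<And>t. h (- t) = h t"
  shows "(\<Sum>i<N. \<Sum>j<N. h (int i - int j)) \<le> 2 * real N * (\<Sum>t<N. h (int t))"
proof -
  have "(\<Sum>j<N. h (int i - int j)) \<le> 2 * (\<Sum>t<N. h (int t))" if i: "i < N" for i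
  proof -
    have "{..<N} = {..i} \<union> {i<..<N}" using i by auto
    then have "(\<Sum>j<N. h (int i - int j)) = (\<Sum>j\<le>i. h (int i - int j)) + (\<Sum>j\<in>{i<..<N}. h (int i - int j))"
      by (simp add: sum.union_disjoint ivl_disj_int)
    moreover have "(\<Sum>j\<le>i. h (int i - int j)) \<le> (\<Sum>t<N. h (int t))"
    proof (rule sum_le_included[where i = "\<lambda>t. i - t"])
      show "\<forall>x\<in>{..i}. \<exists>y\<in>{..<N}. i - y = x \<and> h (int i - int x) \<le> h (int y)"
      proof
        fix x assume "x \<in> {..i}"
        then show "\<exists>y\<in>{..<N}. i - y = x \<and> h (int i - int x) \<le> h (int y)"
          using i by (intro bexI[of _ "i - x"]) (auto simp: of_nat_diff)
      qed
    qed (auto simp: nonneg)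
    moreover have "(\<Sum>j\<in>{i<..<N}. h (int i - int j)) \<le> (\<Sum>t<N. h (int t))"
    proof (rule sum_le_included[where i = "\<lambda>t. i + t"])
      show "\<forall>x\<in>{i<..<N}. \<exists>y\<in>{..<N}. i + y = x \<and> h (int i - int x) \<le> h (int y)"
      proof
        fix x assume "x \<in> {i<..<N}"
        then show "\<exists>y\<in>{..<N}. i + y = x \<and> h (int i - int x) \<le> h (int y)"
          using even[of "int i - int x"] by (intro bexI[of _ "x - i"]) (auto simp: of_nat_diff)
      qed
    qed (auto simp: nonneg)
    ultimately show ?thesis by linarith
  qed
  then have "(\<Sum>i<N. \<Sum>j<N. h (int i - int j)) \<le> (\<Sum>i<N. 2 * (\<Sum>t<N. h (int t)))"
    by (intro sum_mono) auto
  then show ?thesis by simp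
qed

text \<open>
  The operator norm is at most the Hilbert--Schmidt norm, which for a Toeplitz matrix is a Cesaro sum.
  By Wiener's lemma this crude bound is already small compared with \<open>N\<close> if there are no atoms.
\<close>

lemma correlation_matrix_norm_le:
  assumes even: "\<And>t. b (- t) = b t"
  shows "hilbert_norm_mat (correlation_matrix b N) / real N \<le> sqrt (2 * ((\<Sum>t<N. (b (int t))\<^sup>2) / real N))"
proof (cases "N = 0")
  case False
  have "hilbert_norm_mat (correlation_matrix b N) \<le> sqrt (\<Sum>i<N. \<Sum>j<N. (b (int i - int j))\<^sup>2)"
    using hilbert_norm_mat_le_hilbert_schmidt[OF correlation_matrix_carrier]
    by (simp add: correlation_matrix_index)
  also have "\<dots> \<le> sqrt (2 * real N * (\<Sum>t<N. (b (int t))\<^sup>2))"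
    using sum_toeplitz_le[of "\<lambda>t. (b t)\<^sup>2" N] even by simp
  finally have "hilbert_norm_mat (correlation_matrix b N) / real N \<le>
      sqrt (2 * real N * (\<Sum>t<N. (b (int t))\<^sup>2)) / sqrt ((real N)\<^sup>2)"
    by (simp add: divide_right_mono)
  also have "\<dots> = sqrt (2 * ((\<Sum>t<N. (b (int t))\<^sup>2) / real N))"
    unfolding real_sqrt_divide[symmetric] using False by (simp add: power2_eq_square)
  finally show ?thesis .
qed simp

text \<open>
  The quadratic form of the matrix at the vector \<open>(iexp (k * x))\<close>, whose squared norm is \<open>N\<close>, is the integral of
  the unnormalised Fejer kernel \<open>|S y|\<^sup>2\<close> centred at \<open>x\<close>. This kernel equals \<open>N\<^sup>2\<close> at \<open>x\<close> itself, so an atom at \<open>x\<close>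
  contributes \<open>N\<^sup>2\<close> times its mass, whereas the form is at most \<open>N\<close> times the operator norm.
\<close>

lemma atom_le_correlation_matrix_norm:
  assumes \<mu>: "real_distribution \<mu>" and char: "\<And>t. char \<mu> (of_int t) = of_real (b t)" and N: "N > 0"
  shows "measure \<mu> {x} \<le> hilbert_norm_mat (correlation_matrix b N) / real N"
proof -
  interpret real_distribution \<mu> by fact
  define Q where "Q = correlation_matrix b N"
  have Q: "Q \<in> carrier_mat N N" by (simp add: Q_def correlation_matrix_carrier)
  define v where "v = vec N (\<lambda>k. iexp (real k * x))"
  have v: "v \<in> carrier_vec N" by (simp add: v_def)
  have nv: "(hilbert_norm_vec v)\<^sup>2 = real N"
    by (simp add: hilbert_norm_vec_power2 v_def)
  define S where "S y = (\<Sum>j<N. iexp (real j * (y - x)))" for y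
  have S_le: "cmod (S y) \<le> real N" for y
    unfolding S_def by (rule order_trans[OF norm_sum]) simp
  have S_meas: "(\<lambda>y. (cmod (S y))\<^sup>2) \<in> borel_measurable \<mu>"
    unfolding S_def by measurable
  have S_int: "integrable \<mu> (\<lambda>y. (cmod (S y))\<^sup>2)"
    using S_meas by (intro integrable_const_bound[of _ "(real N)\<^sup>2"]) (auto intro!: power_mono S_le)
  have "(Q *\<^sub>v v) \<bullet>c v = of_real (\<integral>y. (cmod (S y))\<^sup>2 \<partial>\<mu>)"
  proof -
    have ie: "integrable \<mu> (\<lambda>y. iexp (of_int (int j - int k) * y))" for j k
      by (rule integrable_iexp) auto
    have "(Q *\<^sub>v v) \<bullet>c v =
        (\<Sum>j<N. \<Sum>k<N. iexp (- real j * x) * iexp (real k * x) * char \<mu> (of_int (int j - int k)))"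
      unfolding Q_def correlation_matrix_quadratic_form[OF v] char
      by (intro sum.cong) (auto simp: v_def exp_cnj)
    also have "\<dots> = (\<Sum>j<N. \<Sum>k<N. \<integral>y. iexp (- real j * x) * iexp (real k * x) * iexp (of_int (int j - int k) * y) \<partial>\<mu>)"
      unfolding char_def by (simp only: integral_mult_right_zero)
    also have "\<dots> = (\<integral>y. (\<Sum>j<N. \<Sum>k<N. iexp (- real j * x) * iexp (real k * x) * iexp (of_int (int j - int k) * y)) \<partial>\<mu>)"
      using ie by (subst Bochner_Integration.integral_sum | (intro sum.cong refl Bochner_Integration.integrable_sum integrable_mult_right ie))+
    also have "\<dots> = (\<integral>y. of_real ((cmod (S y))\<^sup>2) \<partial>\<mu>)"
    proof (intro Bochner_Integration.integral_cong refl)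
      fix y
      have "of_real ((cmod (S y))\<^sup>2) = S y * cnj (S y)" by (rule complex_norm_square)
      also have "\<dots> = (\<Sum>j<N. \<Sum>k<N. iexp (real j * (y - x)) * cnj (iexp (real k * (y - x))))"
        by (simp add: S_def sum_product)
      also have "\<dots> = (\<Sum>j<N. \<Sum>k<N. iexp (- real j * x) * iexp (real k * x) * iexp (of_int (int j - int k) * y))"
        by (intro sum.cong refl) (simp add: exp_cnj exp_add[symmetric] algebra_simps)
      finally show "(\<Sum>j<N. \<Sum>k<N. iexp (- real j * x) * iexp (real k * x) * iexp (of_int (int j - int k) * y)) =
        of_real ((cmod (S y))\<^sup>2)" by simp
    qed
    finally show ?thesis by (simp only: integral_complex_of_real)
  qed
  then have "(\<integral>y. (cmod (S y))\<^sup>2 \<partial>\<mu>) \<le> cmod ((Q *\<^sub>v v) \<bullet>c v)"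
    by simp
  also have "\<dots> \<le> hilbert_norm_vec (Q *\<^sub>v v) * hilbert_norm_vec v"
    using Q v by (intro cscalar_prod_le[of _ N] mult_mat_vec_carrier) auto
  also have "\<dots> \<le> hilbert_norm_mat Q * hilbert_norm_vec v * hilbert_norm_vec v"
    by (intro mult_right_mono hilbert_norm_mult_mat_vec_le_hilbert_norm_mat[OF Q v] hilbert_norm_vec_nonneg)
  also have "\<dots> = hilbert_norm_mat Q * real N"
    using nv by (simp add: power2_eq_square mult.assoc)
  finally have upper: "(\<integral>y. (cmod (S y))\<^sup>2 \<partial>\<mu>) \<le> hilbert_norm_mat Q * real N" .
  have "(real N)\<^sup>2 * measure \<mu> {x} = (\<integral>y. (real N)\<^sup>2 * indicator {x} y \<partial>\<mu>)"
    by simp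
  also have "\<dots> \<le> (\<integral>y. (cmod (S y))\<^sup>2 \<partial>\<mu>)"
  proof (rule integral_mono)
    fix y
    show "(real N)\<^sup>2 * indicator {x} y \<le> (cmod (S y))\<^sup>2"
      by (cases "y = x") (auto simp: S_def)
  qed (auto intro!: S_int integrable_mult_right integrable_real_indicator simp: less_top[symmetric])
  finally have "(real N)\<^sup>2 * measure \<mu> {x} \<le> hilbert_norm_mat Q * real N"
    using upper by linarith
  then show ?thesis using N by (simp add: Q_def power2_eq_square field_simps)
qed

section \<open>Correlation functions of stationary processes\<close>

lemma correlation_function_diff:
  assumes "stationary_process M \<xi>"
  shows "correlation_function M \<xi> (j - k) = (\<integral>\<omega>. \<xi> j \<omega> * \<xi> k \<omega> \<partial>M)"
proof -
  have "(\<integral>\<omega>. \<xi> (j - k + 0) \<omega> * \<xi> 0 \<omega> \<partial>M) = (\<integral>\<omega>. \<xi> (j - k + k) \<omega> * \<xi> k \<omega> \<partial>M)"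
    using assms unfolding stationary_process_def by blast
  then show ?thesis by (simp add: correlation_function_def)
qed

lemma correlation_function_even:
  assumes "stationary_process M \<xi>"
  shows "correlation_function M \<xi> (- t) = correlation_function M \<xi> t"
  using correlation_function_diff[OF assms, of 0 t] correlation_function_diff[OF assms, of t 0]
  by (simp add: mult.commute)

text \<open>
  This is why correlation functions are positive definite: the quadratic form is the second moment of
  a linear combination of the random variables.
\<close>

lemma correlation_quadratic_form:
  assumes "stationary_process M \<xi>"
  shows "(\<Sum>j<N. \<Sum>k<N. c j * cnj (c k) * of_real (correlation_function M \<xi> (int j - int k))) =
    of_real (\<integral>\<omega>. (cmod (\<Sum>j<N. c j * of_real (\<xi> (int j) \<omega>)))\<^sup>2 \<partial>M)"
proof -
  have meas: "\<xi> j \<in> borel_measurable M" and sq: "integrable M (\<lambda>\<omega>. (\<xi> j \<omega>)\<^sup>2)" for j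
    using assms by (auto simp: stationary_process_def)
  have int: "integrable M (\<lambda>\<omega>. \<xi> j \<omega> * \<xi> k \<omega>)" for j k
  proof (rule Bochner_Integration.integrable_bound)
    show "integrable M (\<lambda>\<omega>. (\<xi> j \<omega>)\<^sup>2 + (\<xi> k \<omega>)\<^sup>2)" by (intro Bochner_Integration.integrable_add sq)
    show "(\<lambda>\<omega>. \<xi> j \<omega> * \<xi> k \<omega>) \<in> borel_measurable M" using meas by measurable
    have "\<bar>x * y\<bar> \<le> x\<^sup>2 + y\<^sup>2" for x y :: real
    proof -
      have "0 \<le> (\<bar>x\<bar> - \<bar>y\<bar>)\<^sup>2" by simp
      then have "2 * \<bar>x * y\<bar> \<le> x\<^sup>2 + y\<^sup>2" by (simp add: power2_diff abs_mult)
      then show ?thesis by linarith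
    qed
    then show "AE \<omega> in M. norm (\<xi> j \<omega> * \<xi> k \<omega>) \<le> norm ((\<xi> j \<omega>)\<^sup>2 + (\<xi> k \<omega>)\<^sup>2)"
      by simp
  qed
  have int': "integrable M (\<lambda>\<omega>. c j * cnj (c k) * complex_of_real (\<xi> (int j) \<omega> * \<xi> (int k) \<omega>))" for j k
    by (intro integrable_mult_right integrable_of_real int)
  have "complex_of_real (\<integral>\<omega>. (cmod (\<Sum>j<N. c j * of_real (\<xi> (int j) \<omega>)))\<^sup>2 \<partial>M) =
      (\<integral>\<omega>. complex_of_real ((cmod (\<Sum>j<N. c j * of_real (\<xi> (int j) \<omega>)))\<^sup>2) \<partial>M)"
    by (rule integral_complex_of_real[symmetric])
  also have "\<dots> = (\<integral>\<omega>. (\<Sum>j<N. \<Sum>k<N. c j * cnj (c k) * of_real (\<xi> (int j) \<omega> * \<xi> (int k) \<omega>)) \<partial>M)"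
    unfolding complex_norm_square by (simp add: sum_product mult_ac)
  also have "\<dots> = (\<Sum>j<N. \<Sum>k<N. \<integral>\<omega>. c j * cnj (c k) * of_real (\<xi> (int j) \<omega> * \<xi> (int k) \<omega>) \<partial>M)"
    by (subst Bochner_Integration.integral_sum | (intro sum.cong refl Bochner_Integration.integrable_sum int'))+
  also have "\<dots> = (\<Sum>j<N. \<Sum>k<N. c j * cnj (c k) * of_real (correlation_function M \<xi> (int j - int k)))"
    unfolding correlation_function_diff[OF assms]
    by (simp only: integral_mult_right_zero integral_complex_of_real)
  finally show ?thesis by simp
qed

section \<open>Stability and the growth of the maximal eigenvalue\<close>

theorem theorem3p1:
  fixes M :: "'a measure" and \<xi> :: "int \<Rightarrow> 'a \<Rightarrow> real"
    and b :: "int \<Rightarrow> real" and Q :: "nat \<Rightarrow> complex mat" and lambda_m :: "nat \<Rightarrow> real"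
  assumes "prob_space M"
    and "stationary_process M \<xi>"
    and "\<And>t. (\<integral>\<omega>. \<xi> t \<omega> \<partial>M) = 0"
    and "\<And>t. (\<integral>\<omega>. (\<xi> t \<omega>)\<^sup>2 \<partial>M) = 1"
  defines "b \<equiv> correlation_function M \<xi>"
    and "Q \<equiv> correlation_matrix b"
    and "lambda_m \<equiv> (\<lambda>N. max_eigenvalue (Q N))"
  shows "(\<forall>N\<ge>1. lambda_m N = hilbert_norm_mat (Q N)) \<and>
    (stable_process M \<xi> \<longleftrightarrow> (\<lambda>N. lambda_m N / real N) \<longlonglongrightarrow> 0) \<and>
    (stable_process M \<xi> \<longleftrightarrow> (\<lambda>N. (1 / real N) * hilbert_norm_mat (Q N)) \<longlonglongrightarrow> 0)"
proof -
  have even: "b (- t) = b t" for t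
    unfolding b_def by (rule correlation_function_even) fact
  have b0: "b 0 = 1"
    using assms(4)[of 0] by (simp add: b_def correlation_function_def power2_eq_square)
  have form: "(\<Sum>j<N. \<Sum>k<N. c j * cnj (c k) * of_real (b (int j - int k))) \<in> \<real>\<^sub>\<ge>\<^sub>0" for N and c :: "nat \<Rightarrow> complex"
    unfolding b_def correlation_quadratic_form[OF assms(2)] nonneg_Reals_of_real_iff
    by (rule integral_nonneg_AE) simp
  have norm_eq: "lambda_m N = hilbert_norm_mat (Q N)" if "N \<ge> 1" for N
    unfolding lambda_m_def Q_def
  proof (rule max_eigenvalue_eq_hilbert_norm_mat[OF correlation_matrix_carrier])
    show "N > 0" using that by simp
    fix i j assume "i < N" "j < N"
    then show "correlation_matrix b N $$ (i, j) = cnj (correlation_matrix b N $$ (j, i))"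
      using even[of "int i - int j"] by (simp add: correlation_matrix_index)
  next
    fix v :: "complex Matrix.vec" assume "v \<in> carrier_vec N"
    then show "0 \<le> Re ((correlation_matrix b N *\<^sub>v v) \<bullet>c v)"
      using form[where N = N and c = "\<lambda>j. cnj (vec_index v j)"]
      by (auto simp: correlation_matrix_quadratic_form complex_nonneg_Reals_iff)
  qed
  have stable_iff: "stable_process M \<xi> \<longleftrightarrow> (\<lambda>N. (1 / real N) * hilbert_norm_mat (Q N)) \<longlonglongrightarrow> 0"
  proof
    assume "stable_process M \<xi>"
    then obtain \<mu> where \<mu>: "real_distribution \<mu>" and atomless: "\<And>x. measure \<mu> {x} = 0"
      and char: "\<And>t. char \<mu> (of_int t) = of_real (b t)"
      using spectral_measure_of_continuous_distribution_function
      unfolding stable_process_def b_def[symmetric] by blast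
    have "cmod (char \<mu> (real k)) = \<bar>b (int k)\<bar>" for k
      using char[of "int k"] by simp
    then have "(\<lambda>N. (\<Sum>t<N. (b (int t))\<^sup>2) / real N) \<longlonglongrightarrow> 0"
      using real_distribution.wiener_atomless[OF \<mu> atomless] by simp
    from tendsto_real_sqrt[OF tendsto_mult_right[OF this, of 2]]
    have upper_lim: "(\<lambda>N. sqrt (2 * ((\<Sum>t<N. (b (int t))\<^sup>2) / real N))) \<longlonglongrightarrow> 0"
      by (simp add: mult.commute)
    have lower: "0 \<le> (1 / real N) * hilbert_norm_mat (Q N)" for N
    proof (cases "N = 0")
      case False
      from hilbert_norm_mat_attained[OF correlation_matrix_carrier[of b N]]
      have "0 \<le> hilbert_norm_mat (Q N)"
        unfolding Q_def by (metis hilbert_norm_vec_nonneg)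
      then show ?thesis by simp
    qed simp
    have upper: "(1 / real N) * hilbert_norm_mat (Q N) \<le> sqrt (2 * ((\<Sum>t<N. (b (int t))\<^sup>2) / real N))" for N
      using correlation_matrix_norm_le[of b N, OF even] by (simp add: Q_def)
    show "(\<lambda>N. (1 / real N) * hilbert_norm_mat (Q N)) \<longlonglongrightarrow> 0"
      by (rule tendsto_sandwich[OF always_eventually always_eventually tendsto_const upper_lim])
        (use lower upper in blast)+
  next
    assume lim: "(\<lambda>N. (1 / real N) * hilbert_norm_mat (Q N)) \<longlonglongrightarrow> 0"
    obtain \<mu> where \<mu>: "real_distribution \<mu>" "measure \<mu> {-pi..pi} = 1"
      and char: "\<And>t. char \<mu> (of_int t) = of_real (b t)"
      using herglotz[of "\<lambda>t. of_real (b t)"] form b0 by auto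
    have "measure \<mu> {x} = 0" for x
    proof -
      have "\<forall>\<^sub>F N in sequentially. measure \<mu> {x} \<le> (1 / real N) * hilbert_norm_mat (Q N)"
        using eventually_gt_at_top[of 0]
      proof eventually_elim
        case (elim N)
        then show ?case
          using atom_le_correlation_matrix_norm[where b = b and x = x, OF \<mu>(1) char elim] by (simp add: Q_def)
      qed
      then have "measure \<mu> {x} \<le> 0"
        using tendsto_lowerbound[OF lim] by simp
      then show ?thesis using measure_nonneg[of \<mu> "{x}"] by simp
    qed
    then show "stable_process M \<xi>"
      using continuous_distribution_function_of_spectral_measure[OF \<mu>] char
      unfolding stable_process_def b_def[symmetric] by blast
  qed
  have "(\<lambda>N. lambda_m N / real N) = (\<lambda>N. (1 / real N) * hilbert_norm_mat (Q N))"
  proof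
    fix N show "lambda_m N / real N = (1 / real N) * hilbert_norm_mat (Q N)"
      using norm_eq[of N] by (cases "N = 0") auto
  qed
  then show ?thesis using norm_eq stable_iff by auto
qed

end
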